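(* Let $d,J\in\mathbb{N}$, $T>0$, $\tau=\frac{T}{J}$, and let $t_j=j\tau$ ($j=0,\dots,J$) be the uniform mesh of $[0,T]$. Let $p^J$ be the probability density function of the Euler iterate $\mathbf{Y}^J$ defined in the context, and let $\mathbf{Y}^{J,1},\mathbf{Y}^{J,2},\dots$ be i.i.d. copies of $\mathbf{Y}^J$ on a probability space with probability measure $\mathbb{P}$. For each admissible $M\in\mathbb{N}$ (see context) let $k_M\in\mathbb{N}$ with $k_M<M$, let $D_M^J=\{\mathbf{Y}^{J,m}\}_{m=1}^M$, and let $\widehat{p}^{J,M}_{\mathrm{Ges}}$ be Gessaman's estimator built from $D_M^J$ and $k_M$ as described in the context. If $k_M\to\infty$ and $\frac{k_M}{M}\to 0$ as $M\to\infty$, then $\widehat{p}^{J,M}_{\mathrm{Ges}}$ is strongly $L^1$-consistent, i.e. $$\big\|p^J-\widehat{p}^{J,M}_{\mathrm{Ges}}\big\|_{L^1(\mathbb{R}^d)}\to 0\qquad \mathbb{P}\text{-almost surely, as } M\to\infty .$$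
   Context: **Standing assumptions.** (i) $\mathbf{b}\in C^\infty(\mathbb{R}^d;\mathbb{R}^d)$ with bounded derivatives of any order. (ii) $\boldsymbol{\sigma}\in C^\infty(\mathbb{R}^d;\mathbb{R}^{d\times d})$ with bounded derivatives, and there is $\theta>0$ with $\langle \mathbf{y},\boldsymbol{\sigma}(\mathbf{x})\boldsymbol{\sigma}^\top(\mathbf{x})\mathbf{y}\rangle\ge\theta\|\mathbf{y}\|^2$ for all $\mathbf{x},\mathbf{y}\in\mathbb{R}^d$. (iii) $p_0:\mathbb{R}^d\to[0,\infty)$ is a probability density function. **Euler scheme.** Let $\mathbf{W}$ be an $\mathbb{R}^d$-valued Wiener process on $[0,T]$ and $\mathbf{X}^0$ an $\mathbb{R}^d$-valued random variable with density $p_0$, independent of $\mathbf{W}$. Set $\mathbf{Y}^0=\mathbf{X}^0$ and $$\mathbf{Y}^{j+1}=\mathbf{Y}^j+\tau\,\mathbf{b}(\mathbf{Y}^j)+\boldsymbol{\sigma}(\mathbf{Y}^j)(\mathbf{W}_{t_{j+1}}-\mathbf{W}_{t_j}),\qquad j=0,\dots,J-1.$$ Under the assumptions the law of $\mathbf{Y}^J$ has a density $p^J$ with respect to Lebesgue measure. **Admissible $M$.** Given $M$ and $k_M$, put $N=N_M=\big\lceil (M/k_M)^{1/d}\big\rceil$. Gessaman's rule is applied for those $M$ for which the equal splitting below is possible, i.e. $N^d$ divides $M$. The limit $M\to\infty$ is taken along such $M$ (an infinite set of $M$). **Gessaman's rule.** Set $\mathcal{R}^M_{0,0}=\mathbb{R}^d$.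 For $i=0,\dots,d-1$ and $j=0,\dots,N^i-1$, decompose the cell $\mathcal{R}^M_{i,j}$ into the $N$ hyper-rectangles $$\mathcal{R}^M_{i+1,Nj+\ell}=\mathcal{R}^M_{i,j}\cap\big(\mathbb{R}^i\times[x_\ell,x_{\ell+1})\times\mathbb{R}^{d-1-i}\big),\qquad \ell=0,\dots,N-1,$$ where $-\infty=x_0<x_1<\dots<x_{N-1}<x_N=\infty$ are cut points (depending on the cell $(i,j)$, with $[x_0,x_1)$ read as $(-\infty,x_1)$), chosen by a measurable rule as a function of the sample, such that each $\mathcal{R}^M_{i+1,Nj+\ell}$ contains exactly $M/N^{i+1}$ points of the sample $D_M^J$. (Since $p^J$ is a density, almost surely no two sample points share a coordinate value, so such cut points exist almost surely.) The resulting partition of $\mathbb{R}^d$ is $\{\mathbf{R}_r : r=0,\dots,N^d-1\}$ with $\mathbf{R}_r=\mathcal{R}^M_{d,r}$. **Gessaman's estimator.** $$\widehat{p}^{J,M}_{\mathrm{Ges}}(\mathbf{x})=\sum_{r=0}^{N^d-1}\frac{k_M}{M\cdot\mathrm{vol}(\mathbf{R}_r)}\,\mathbb{1}_{\{\mathbf{x}\in\mathbf{R}_r\}},\qquad \mathbf{x}\in\mathbb{R}^d,$$ where $\mathrm{vol}(\mathbf{R}_r)\in(0,\infty]$ is the Lebesgue volume, and the corresponding term is $0$ if the volume is infinite. *)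

theory Defs
  imports "HOL-Probability.Probability"
begin

subsection \<open>Coefficients\<close>

primrec iter_partial :: "'d list \<Rightarrow> (real ^ 'd \<Rightarrow> 'b::real_normed_vector) \<Rightarrow> real ^ 'd \<Rightarrow> 'b" where
  "iter_partial [] f = f"
| "iter_partial (k # ks) f = (\<lambda>x. frechet_derivative (iter_partial ks f) (at x) (axis k 1))"

text \<open>
  Differentiability of every iterated partial derivative makes all of them exist and be continuous,
  which is membership in C-infinity. Only derivatives of order at least one are required to be
  bounded; the function itself may grow linearly.
\<close>

definition smooth_bounded_derivs :: "(real ^ 'd \<Rightarrow> 'b::real_normed_vector) \<Rightarrow> bool" where
  "smooth_bounded_derivs f \<longleftrightarrow>
     (\<forall>ks x. iter_partial ks f differentiable (at x)) \<and>
     (\<forall>ks. ks \<noteq> [] \<longrightarrow> bounded (range (iter_partial ks f)))"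

definition uniformly_elliptic :: "(real ^ 'd \<Rightarrow> real ^ 'd ^ 'd) \<Rightarrow> bool" where
  "uniformly_elliptic \<sigma> \<longleftrightarrow>
     (\<exists>\<theta>>0. \<forall>x y. y \<bullet> ((\<sigma> x ** transpose (\<sigma> x)) *v y) \<ge> \<theta> * (norm y)\<^sup>2)"


subsection \<open>Wiener process and Euler scheme\<close>

definition wiener_process :: "'a measure \<Rightarrow> real \<Rightarrow> (real \<Rightarrow> 'a \<Rightarrow> real ^ 'd) \<Rightarrow> bool" where
  "wiener_process \<Omega> T W \<longleftrightarrow>
     (\<forall>t\<in>{0..T}. W t \<in> borel_measurable \<Omega>) \<and>
     (AE \<omega> in \<Omega>. W 0 \<omega> = 0) \<and>
     (\<forall>(n::nat) t. strict_mono_on {..n} t \<and> t ` {..n} \<subseteq> {0..T} \<longrightarrow>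
        prob_space.indep_vars \<Omega> (\<lambda>_. borel) (\<lambda>i \<omega>. W (t (Suc i)) \<omega> - W (t i) \<omega>) {..<n}) \<and>
     (\<forall>s t. 0 \<le> s \<and> s < t \<and> t \<le> T \<longrightarrow>
        distributed \<Omega> lborel (\<lambda>\<omega>. W t \<omega> - W s \<omega>)
          (\<lambda>x. ennreal (\<Prod>k\<in>UNIV. normal_density 0 (sqrt (t - s)) (x $ k)))) \<and>
     (AE \<omega> in \<Omega>. continuous_on {0..T} (\<lambda>t. W t \<omega>))"

text \<open>
  The library's \<open>indep_var\<close> needs both random variables to have values in the same type, which a
  random vector and the path of a process do not have; here it is stated without that
  restriction. The preimage families are already sigma-algebras.
\<close>

definition independent_rvs ::
  "'a measure \<Rightarrow> 'b measure \<Rightarrow> ('a \<Rightarrow> 'b) \<Rightarrow> 'c measure \<Rightarrow> ('a \<Rightarrow> 'c) \<Rightarrow> bool" where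
  "independent_rvs \<Omega> S X S' X' \<longleftrightarrow>
     X \<in> measurable \<Omega> S \<and> X' \<in> measurable \<Omega> S' \<and>
     prob_space.indep_set \<Omega>
       {X -` B \<inter> space \<Omega> | B. B \<in> sets S} {X' -` B \<inter> space \<Omega> | B. B \<in> sets S'}"

primrec euler ::
  "(real ^ 'd \<Rightarrow> real ^ 'd) \<Rightarrow> (real ^ 'd \<Rightarrow> real ^ 'd ^ 'd) \<Rightarrow> real \<Rightarrow>
   ('a \<Rightarrow> real ^ 'd) \<Rightarrow> (real \<Rightarrow> 'a \<Rightarrow> real ^ 'd) \<Rightarrow> nat \<Rightarrow> 'a \<Rightarrow> real ^ 'd" where
  "euler b \<sigma> \<tau> X0 W 0 = X0"
| "euler b \<sigma> \<tau> X0 W (Suc j) = (\<lambda>\<omega>.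
     euler b \<sigma> \<tau> X0 W j \<omega> + \<tau> *\<^sub>R b (euler b \<sigma> \<tau> X0 W j \<omega>)
       + \<sigma> (euler b \<sigma> \<tau> X0 W j \<omega>) *v (W (real (Suc j) * \<tau>) \<omega> - W (real j * \<tau>) \<omega>))"


subsection \<open>Gessaman's rule\<close>

definition gessaman_N :: "nat \<Rightarrow> (nat \<Rightarrow> nat) \<Rightarrow> nat \<Rightarrow> nat" where
  "gessaman_N d k M = nat \<lceil>(real M / real (k M)) powr (1 / real d)\<rceil>"

definition admissible :: "nat \<Rightarrow> (nat \<Rightarrow> nat) \<Rightarrow> nat set" where
  "admissible d k = {M. 0 < M \<and> 0 < k M \<and> gessaman_N d k M ^ d dvd M}"

text \<open>
  The index type of the coordinates carries no order, so the order in which the coordinates are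
  split is given by an enumeration \<open>e\<close>: stage \<open>i\<close> cuts coordinate \<open>e i\<close>. The \<open>l\<close>-th cut point of
  cell \<open>j\<close> of stage \<open>i\<close> is \<open>x i j l\<close>, with minus infinity for \<open>l = 0\<close> and infinity for \<open>l = N\<close>.
  The index \<open>r = N * j + l\<close> is decoded as \<open>j = r div N\<close> and \<open>l = r mod N\<close>; at stage \<open>0\<close> only
  \<open>r = 0\<close> is meaningful.
\<close>

primrec gessaman_cell ::
  "(nat \<Rightarrow> 'd) \<Rightarrow> nat \<Rightarrow> (nat \<Rightarrow> nat \<Rightarrow> nat \<Rightarrow> ereal) \<Rightarrow> nat \<Rightarrow> nat \<Rightarrow> (real ^ 'd) set" where
  "gessaman_cell e N x 0 r = UNIV"
| "gessaman_cell e N x (Suc i) r =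
     gessaman_cell e N x i (r div N) \<inter>
     {y. x i (r div N) (r mod N) \<le> ereal (y $ e i) \<and> ereal (y $ e i) < x i (r div N) (Suc (r mod N))}"

definition gessaman_cuts ::
  "(nat \<Rightarrow> 'd) \<Rightarrow> nat \<Rightarrow> nat \<Rightarrow> (nat \<Rightarrow> real ^ 'd) \<Rightarrow> (nat \<Rightarrow> nat \<Rightarrow> nat \<Rightarrow> ereal) \<Rightarrow> bool" where
  "gessaman_cuts e N M s x \<longleftrightarrow>
     (\<forall>i<CARD('d). \<forall>j<N ^ i.
        x i j 0 = -\<infinity> \<and> x i j N = \<infinity> \<and> strict_mono_on {..N} (x i j) \<and>
        (\<forall>l<N. card {m. m < M \<and> s m \<in> gessaman_cell e N x (Suc i) (N * j + l)} = M div N ^ Suc i))"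

text \<open>
  A rule maps the sample size \<open>M\<close> and the sample, a family indexed by \<open>{..<M}\<close>, to cut points.
\<close>

definition measurable_cut_rule ::
  "nat \<Rightarrow> nat \<Rightarrow> nat \<Rightarrow> ((nat \<Rightarrow> real ^ 'd) \<Rightarrow> nat \<Rightarrow> nat \<Rightarrow> nat \<Rightarrow> ereal) \<Rightarrow> bool" where
  "measurable_cut_rule d N M c \<longleftrightarrow>
     (\<forall>i<d. \<forall>j<N ^ i. \<forall>l\<le>N. (\<lambda>s. c s i j l) \<in> borel_measurable (Pi\<^sub>M {..<M} (\<lambda>_. borel)))"

definition gessaman_estimator ::
  "(nat \<Rightarrow> 'd) \<Rightarrow> nat \<Rightarrow> nat \<Rightarrow> nat \<Rightarrow> (nat \<Rightarrow> nat \<Rightarrow> nat \<Rightarrow> ereal) \<Rightarrow> real ^ 'd \<Rightarrow> real" where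
  "gessaman_estimator e N M k x y =
     (\<Sum>r<N ^ CARD('d).
        let R = gessaman_cell e N x CARD('d) r in
        (if emeasure lborel R = \<infinity> then 0 else real k / (real M * measure lborel R)) * indicator R y)"

end

theory Submission
  imports Defs
begin

text \<open>
  The argument works for i.i.d. points with any density \<open>p\<close>; write \<open>\<mu>\<close> for their law.
  Fix \<open>K\<close> and let \<open>Q\<close> be the deterministic nested partition that splits \<open>\<mu>\<close> into \<open>(K N)\<^sup>d\<close> cells of
  equal mass. Since \<open>N\<^sup>d / M\<close> tends to \<open>0\<close>, Hoeffding's inequality, a union bound over all unions of
  \<open>Q\<close>-cells and Borel-Cantelli bound the excess of the empirical mass over \<open>\<mu>\<close> uniformly on these
  unions. Whatever the data-dependent cuts are, each stage cuts through at most a fraction \<open>1 / K\<close> of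
  the \<open>Q\<close>-cells, and all others lie inside a single cell of Gessaman's partition. Hence the masses
  of Gessaman's cells are within \<open>o(1)\<close> of \<open>N\<^sup>-\<^sup>d\<close>, in total over the cells, and no
  growth function of the class of partitions is needed.

  For the bias, every child interval that is long must contain one of finitely many grid points, so
  all but a fraction \<open>O(1 / N)\<close> of the cells that meet a given box are small. On the small cells \<open>p\<close> is
  compared with a continuous function that is close to it in the L1 norm.
\<close>

section \<open>Cells of a nested partition\<close>

text \<open>The part of \<open>gessaman_cuts\<close> that does not mention the sample. It is shared
  by the data-dependent partition and by the deterministic quantile partition, so the facts on cells
  apply to both.\<close>

definition cut_structure :: "nat \<Rightarrow> nat \<Rightarrow> (nat \<Rightarrow> nat \<Rightarrow> nat \<Rightarrow> ereal) \<Rightarrow> bool" where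
  "cut_structure d N x \<longleftrightarrow>
     (\<forall>i<d. \<forall>j<N ^ i. x i j 0 = -\<infinity> \<and> x i j N = \<infinity> \<and> strict_mono_on {..N} (x i j))"

lemma cut_structureD:
  assumes "cut_structure d N x" "i < d" "j < N ^ i"
  shows "x i j 0 = -\<infinity>" "x i j N = \<infinity>" "strict_mono_on {..N} (x i j)"
  using assms unfolding cut_structure_def by auto

lemma cut_index_unique:
  fixes c :: "nat \<Rightarrow> 'a::linorder"
  assumes "strict_mono_on {..N} c" "l < N" "l' < N"
    and "c l \<le> t" "t < c (Suc l)" "c l' \<le> t" "t < c (Suc l')"
  shows "l = l'"
proof (rule ccontr)
  assume "l \<noteq> l'"
  then consider "Suc l \<le> l'" | "Suc l' \<le> l" by linarith
  then show False
  proof cases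
    case 1
    then have "c (Suc l) \<le> c l'"
      using assms by (intro strict_mono_on_leD[OF assms(1)]) auto
    then show False using assms by simp
  next
    case 2
    then have "c (Suc l') \<le> c l"
      using assms by (intro strict_mono_on_leD[OF assms(1)]) auto
    then show False using assms by simp
  qed
qed

text \<open>The least index whose cut exceeds \<open>t\<close> is positive because
  \<open>c 0\<close> does not exceed \<open>t\<close>; its predecessor is the index sought.\<close>

lemma cut_index_exists:
  fixes c :: "nat \<Rightarrow> 'a::linorder"
  assumes "c 0 \<le> t" "t < c N"
  obtains l where "l < N" "c l \<le> t" "t < c (Suc l)"
proof -
  define n where "n = (LEAST n. t < c n)"
  have n: "t < c n" "n \<le> N"
    unfolding n_def using assms by (auto intro: LeastI Least_le)
  with assms obtain l where l: "n = Suc l" by (cases n) auto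
  then have "\<not> t < c l" using not_less_Least[of l "\<lambda>n. t < c n"] by (simp add: n_def)
  with n l that[of l] show ?thesis by auto
qed

lemma div_less_power:
  fixes r N :: nat
  assumes "r < N ^ Suc i"
  shows "r div N < N ^ i" "r mod N < N" "N > 0"
proof -
  show "N > 0" using assms by (cases N) auto
  then show "r mod N < N" by simp
  show "r div N < N ^ i" using assms by (intro less_mult_imp_div_less) (simp add: mult.commute)
qed

lemma mult_add_less_power:
  fixes q l N :: nat
  assumes "q < N ^ i" "l < N"
  shows "N * q + l < N ^ Suc i"
proof -
  have "N * q + l < N * Suc q" using assms by simp
  also have "\<dots> \<le> N * N ^ i" using assms by (intro mult_left_mono) auto
  finally show ?thesis by simp
qed

text \<open>Induction on the stage: the parent is unique, and consecutive half-open intervals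
  running from minus infinity to infinity catch the coordinate exactly once. Disjointness and
  covering are the two halves of this fact.\<close>

lemma gessaman_cell_ex1:
  fixes e :: "nat \<Rightarrow> 'd::finite" and y :: "real ^ 'd"
  assumes "cut_structure d N x" "i \<le> d"
  shows "\<exists>!r. r < N ^ i \<and> y \<in> gessaman_cell e N x i r"
  using assms(2)
proof (induction i)
  case 0
  then show ?case by auto
next
  case (Suc i)
  then obtain q where q: "q < N ^ i" "y \<in> gessaman_cell e N x i q"
    and uniq: "\<And>q'. q' < N ^ i \<Longrightarrow> y \<in> gessaman_cell e N x i q' \<Longrightarrow> q' = q"
    by (metis Suc_leD)
  have c: "x i q 0 = -\<infinity>" "x i q N = \<infinity>" "strict_mono_on {..N} (x i q)"
    using cut_structureD[OF assms(1) _ q(1)] Suc.prems by auto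
  obtain l where l: "l < N" "x i q l \<le> ereal (y $ e i)" "ereal (y $ e i) < x i q (Suc l)"
    using cut_index_exists[of "x i q" "ereal (y $ e i)" N] c by auto
  show ?case
  proof (rule ex1I)
    show "N * q + l < N ^ Suc i \<and> y \<in> gessaman_cell e N x (Suc i) (N * q + l)"
      using mult_add_less_power[OF q(1) l(1)] l q by simp
  next
    fix r assume r: "r < N ^ Suc i \<and> y \<in> gessaman_cell e N x (Suc i) r"
    have "r div N = q" using uniq[of "r div N"] r div_less_power[of r N i] by auto
    moreover have "r mod N = l"
      using cut_index_unique[OF c(3), of "r mod N" l "ereal (y $ e i)"] r l
        div_less_power[of r N i] \<open>r div N = q\<close> by auto
    ultimately show "r = N * q + l" using div_mult_mod_eq[of r N] by (simp add: mult.commute)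
  qed
qed

lemma gessaman_cell_disjoint:
  assumes "cut_structure d N x" "i \<le> d"
  shows "disjoint_family_on (gessaman_cell e N x i) {..<N ^ i}"
  unfolding disjoint_family_on_def
proof (intro ballI impI equals0I)
  fix r s y
  assume "r \<in> {..<N ^ i}" "s \<in> {..<N ^ i}" "r \<noteq> s"
    and "y \<in> gessaman_cell e N x i r \<inter> gessaman_cell e N x i s"
  then show False using gessaman_cell_ex1[OF assms, of y e] by (metis IntE lessThan_iff)
qed

lemma gessaman_cell_cover:
  assumes "cut_structure d N x" "i \<le> d"
  shows "(\<Union>r<N ^ i. gessaman_cell e N x i r) = UNIV"
proof (intro set_eqI iffI UNIV_I)
  fix y
  from gessaman_cell_ex1[OF assms, of y e] obtain r
    where "r < N ^ i" "y \<in> gessaman_cell e N x i r" by (elim ex1E conjE)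
  then show "y \<in> (\<Union>r<N ^ i. gessaman_cell e N x i r)" by blast
qed

lemma sets_gessaman_cell [measurable]: "gessaman_cell e N x i r \<in> sets borel"
proof (induction i arbitrary: r)
  case 0
  then show ?case by simp
next
  case (Suc i)
  have "{y. a \<le> ereal (y $ k) \<and> ereal (y $ k) < b} \<in> sets borel" for a b and k :: 'a
    by measurable
  then show ?case unfolding gessaman_cell.simps by (intro sets.Int Suc)
qed

subsection \<open>Cells whose sides contain a marked point\<close>

text \<open>
  Two choices of the marked points \<open>G\<close> matter: the cuts of a second partition, so that the cells that
  are not hit lie inside one cell of it, and a fixed grid, so that they are small.
\<close>

primrec hit :: "nat \<Rightarrow> (nat \<Rightarrow> nat \<Rightarrow> nat \<Rightarrow> ereal) \<Rightarrow> (nat \<Rightarrow> nat \<Rightarrow> ereal set) \<Rightarrow> nat \<Rightarrow> nat \<Rightarrow> bool"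
where
  "hit N x G 0 r \<longleftrightarrow> False"
| "hit N x G (Suc i) r \<longleftrightarrow> hit N x G i (r div N) \<or>
     (\<exists>g\<in>G i (r div N). x i (r div N) (r mod N) \<le> g \<and> g < x i (r div N) (Suc (r mod N)))"

text \<open>The intervals are disjoint, so a point lies in at most one of them; sending a point to
  its interval therefore maps \<open>G\<close> onto the hit intervals.\<close>

lemma card_hit_intervals_le:
  fixes c :: "nat \<Rightarrow> 'a::linorder"
  assumes "strict_mono_on {..N} c" "finite G"
  shows "card {l. l < N \<and> (\<exists>g\<in>G. c l \<le> g \<and> g < c (Suc l))} \<le> card G"
proof (rule surj_card_le[OF assms(2)])
  let ?f = "\<lambda>g. SOME l. l < N \<and> c l \<le> g \<and> g < c (Suc l)"
  show "{l. l < N \<and> (\<exists>g\<in>G. c l \<le> g \<and> g < c (Suc l))} \<subseteq> ?f ` G"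
  proof safe
    fix l g assume l: "l < N" "g \<in> G" "c l \<le> g" "g < c (Suc l)"
    have "?f g = l"
    proof (rule some_equality)
      show "l < N \<and> c l \<le> g \<and> g < c (Suc l)" using l by simp
      show "l' = l" if "l' < N \<and> c l' \<le> g \<and> g < c (Suc l')" for l'
        using cut_index_unique[OF assms(1), of l' l g] that l by simp
    qed
    then show "l \<in> ?f ` G" using l by blast
  qed
qed

text \<open>All \<open>N\<close> children of a hit parent are hit, and at most \<open>c\<close>
  children of each parent are hit anew. So the number \<open>h i\<close> of hit cells satisfies
  \<open>h (Suc i) \<le> N * h i + c * N ^ i\<close>, and at most a fraction
  \<open>i * c / N\<close> of the cells is hit. The factor \<open>N\<close> on the left keeps the
  bound free of division.\<close>

lemma card_hit_le:
  assumes "cut_structure d N x" "i \<le> d"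
    and G: "\<And>i j. finite (G i j)" "\<And>i j. card (G i j) \<le> c"
  shows "N * card {r. r < N ^ i \<and> hit N x G i r} \<le> i * c * N ^ i"
  using assms(2)
proof (induction i)
  case 0
  then show ?case by simp
next
  case (Suc i)
  define E where "E = (\<lambda>q. {l. l < N \<and> (\<exists>g\<in>G i q. x i q l \<le> g \<and> g < x i q (Suc l))})"
  define H where "H = {r. r < N ^ i \<and> hit N x G i r}"
  have finH: "finite H" unfolding H_def by simp
  have finE: "finite (E q)" for q unfolding E_def by simp
  have cE: "card (E q) \<le> c" if "q < N ^ i" for q
  proof -
    have "i < d" using Suc.prems by simp
    then have "card (E q) \<le> card (G i q)"
      unfolding E_def by (intro card_hit_intervals_le cut_structureD(3)[OF assms(1) _ that] G(1))
    then show ?thesis using G(2)[of i q] by simp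
  qed
  have "{r. r < N ^ Suc i \<and> hit N x G (Suc i) r} \<subseteq>
      (\<Union>q\<in>H. (\<lambda>l. N * q + l) ` {..<N}) \<union> (\<Union>q\<in>{..<N ^ i}. (\<lambda>l. N * q + l) ` E q)"
  proof
    fix r assume r: "r \<in> {r. r < N ^ Suc i \<and> hit N x G (Suc i) r}"
    have eq: "r = N * (r div N) + r mod N" by simp
    have *: "r div N < N ^ i" "r mod N < N" using div_less_power[of r N i] r by auto
    from r consider "hit N x G i (r div N)" | "r mod N \<in> E (r div N)"
      using * unfolding E_def by auto
    then show "r \<in> (\<Union>q\<in>H. (\<lambda>l. N * q + l) ` {..<N}) \<union> (\<Union>q\<in>{..<N ^ i}. (\<lambda>l. N * q + l) ` E q)"
    proof cases
      case 1
      then have "r div N \<in> H" unfolding H_def using * by auto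
      then show ?thesis using eq * by blast
    next
      case 2
      then show ?thesis using eq * by blast
    qed
  qed
  then have "card {r. r < N ^ Suc i \<and> hit N x G (Suc i) r} \<le>
     card ((\<Union>q\<in>H. (\<lambda>l. N * q + l) ` {..<N}) \<union> (\<Union>q\<in>{..<N ^ i}. (\<lambda>l. N * q + l) ` E q))"
    using finH finE by (intro card_mono) auto
  also have "\<dots> \<le> card (\<Union>q\<in>H. (\<lambda>l. N * q + l) ` {..<N}) + card (\<Union>q\<in>{..<N ^ i}. (\<lambda>l. N * q + l) ` E q)"
    by (rule card_Un_le)
  also have "card (\<Union>q\<in>H. (\<lambda>l. N * q + l) ` {..<N}) \<le> (\<Sum>q\<in>H. card ((\<lambda>l. N * q + l) ` {..<N}))"
    by (rule card_UN_le[OF finH])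
  also have "\<dots> \<le> (\<Sum>q\<in>H. N)" by (intro sum_mono order_trans[OF card_image_le]) auto
  also have "\<dots> = card H * N" by simp
  also have "card (\<Union>q\<in>{..<N ^ i}. (\<lambda>l. N * q + l) ` E q) \<le> (\<Sum>q<N ^ i. card ((\<lambda>l. N * q + l) ` E q))"
    by (rule card_UN_le) simp
  also have "\<dots> \<le> (\<Sum>q<N ^ i. c)" 
    using finE cE by (intro sum_mono order_trans[OF card_image_le]) auto
  also have "\<dots> = N ^ i * c" by simp
  finally have "card {r. r < N ^ Suc i \<and> hit N x G (Suc i) r} \<le> card H * N + N ^ i * c" by simp
  then have "N * card {r. r < N ^ Suc i \<and> hit N x G (Suc i) r} \<le> N * (card H * N + N ^ i * c)"
    by (rule mult_left_mono) simp
  also have "\<dots> = (N * card H) * N + N ^ Suc i * c" by (simp add: algebra_simps)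
  also have "\<dots> \<le> (i * c * N ^ i) * N + N ^ Suc i * c"
    using Suc unfolding H_def by (intro add_right_mono mult_right_mono) auto
  finally show ?case by (simp add: algebra_simps)
qed

text \<open>
  If no cell of the partition given by \<open>x\<close> contains the cell \<open>q\<close> of the partition given by \<open>z\<close>, the
  choice below is arbitrary; this is harmless, as such a \<open>q\<close> has already been hit.
\<close>

definition interior_cuts ::
  "(nat \<Rightarrow> 'd::finite) \<Rightarrow> nat \<Rightarrow> (nat \<Rightarrow> nat \<Rightarrow> nat \<Rightarrow> ereal) \<Rightarrow> nat \<Rightarrow>
   (nat \<Rightarrow> nat \<Rightarrow> nat \<Rightarrow> ereal) \<Rightarrow> nat \<Rightarrow> nat \<Rightarrow> ereal set"
where
  "interior_cuts e N x L z i q =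
     x i (SOME j. j < N ^ i \<and> gessaman_cell e L z i q \<subseteq> gessaman_cell e N x i j) ` {0<..<N}"

lemma finite_interior_cuts: "finite (interior_cuts e N x L z i q)"
  by (simp add: interior_cuts_def)

lemma card_interior_cuts_le: "card (interior_cuts e N x L z i q) \<le> N"
  unfolding interior_cuts_def by (rule order_trans[OF card_image_le]) auto

text \<open>By induction the parent of \<open>q\<close> lies in some cell \<open>j\<close>. The
  interval that cuts \<open>q\<close> out of its parent contains no inner cut of \<open>j\<close>,
  hence fits between two consecutive cuts of \<open>j\<close>; the infinite outer cuts cannot
  separate anything.\<close>

lemma not_hit_imp_subset_cell:
  assumes x: "cut_structure d N x" and z: "cut_structure d L z"
    and "i \<le> d" "q < L ^ i" "\<not> hit L z (interior_cuts e N x L z) i q"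
  shows "\<exists>j<N ^ i. gessaman_cell e L z i q \<subseteq> gessaman_cell e N x i j"
  using assms(3-)
proof (induction i arbitrary: q)
  case 0
  then show ?case by simp
next
  case (Suc i)
  define p l where "p = q div L" and "l = q mod L"
  have pl: "p < L ^ i" "l < L" using div_less_power[OF Suc.prems(2)] by (auto simp: p_def l_def)
  define j where "j = (SOME j. j < N ^ i \<and> gessaman_cell e L z i p \<subseteq> gessaman_cell e N x i j)"
  have "\<exists>j. j < N ^ i \<and> gessaman_cell e L z i p \<subseteq> gessaman_cell e N x i j"
    using Suc pl by (simp add: p_def)
  from someI_ex[OF this] have j: "j < N ^ i" "gessaman_cell e L z i p \<subseteq> gessaman_cell e N x i j"
    unfolding j_def by auto
  have nohit: "\<not> (z i p l \<le> x i j m \<and> x i j m < z i p (Suc l))" if "0 < m" "m < N" for m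
    using Suc.prems(3) that unfolding hit.simps p_def[symmetric] l_def[symmetric]
    by (auto simp: interior_cuts_def j_def)
  have cx: "x i j 0 = -\<infinity>" "x i j N = \<infinity>" 
    using cut_structureD[OF x _ j(1)] Suc.prems(1) by auto
  have "z i p l < z i p (Suc l)"
  proof (rule strict_mono_onD[of "{..L}" "z i p"])
    show "strict_mono_on {..L} (z i p)" using Suc.prems(1) by (intro cut_structureD(3)[OF z _ pl(1)]) simp
  qed (use pl in auto)
  \<comment> \<open>The left end may be minus infinity but never infinity, so some interval
    \<open>m\<close> of cell \<open>j\<close> contains it.\<close>
  then have "z i p l < \<infinity>" by auto
  then obtain m where m: "m < N" "x i j m \<le> z i p l" "z i p l < x i j (Suc m)"
    using cut_index_exists[of "x i j" "z i p l" N] cx by auto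
  \<comment> \<open>The cut after \<open>m\<close> exceeds the left end; if it is an inner cut, the
    absence of hits forces it to or past the right end.\<close>
  have le: "z i p (Suc l) \<le> x i j (Suc m)"
  proof (cases "Suc m = N")
    case True
    then show ?thesis using cx by simp
  next
    case False
    then show ?thesis using nohit[of "Suc m"] m by force
  qed
  have "gessaman_cell e L z (Suc i) q \<subseteq> gessaman_cell e N x (Suc i) (N * j + m)"
    using j m le by (auto simp: p_def[symmetric] l_def[symmetric])
  then show ?case using mult_add_less_power[OF j(1) m(1)] by blast
qed

definition grid_points :: "nat \<Rightarrow> real \<Rightarrow> ereal set" where
  "grid_points H \<gamma> = (\<lambda>n. ereal (real_of_int n * \<gamma>)) ` {- int H..int H}"

lemma finite_grid_points: "finite (grid_points H \<gamma>)"
  by (simp add: grid_points_def)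

lemma card_grid_points_le: "card (grid_points H \<gamma>) \<le> 2 * H + 1"
  unfolding grid_points_def by (rule order_trans[OF card_image_le]) auto

text \<open>The point \<open>y\<close> sits between two neighbouring grid points. The side of the
  cell contains \<open>y\<close> but no grid point, so it cannot reach beyond these neighbours, and
  \<open>w\<close> is trapped between them as well.\<close>

lemma not_hit_grid_imp_small:
  fixes y w :: "real ^ 'd::finite"
  assumes "\<gamma> > 0" "\<not> hit N x (\<lambda>_ _. grid_points H \<gamma>) i r"
    and "y \<in> gessaman_cell e N x i r" "w \<in> gessaman_cell e N x i r" "k < i"
    and "- (real H * \<gamma>) \<le> y $ e k" "y $ e k < real H * \<gamma>"
  shows "\<bar>y $ e k - w $ e k\<bar> \<le> \<gamma>" "- (real H * \<gamma>) \<le> w $ e k" "w $ e k \<le> real H * \<gamma>"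
proof -
  have "\<bar>y $ e k - w $ e k\<bar> \<le> \<gamma> \<and> - (real H * \<gamma>) \<le> w $ e k \<and> w $ e k \<le> real H * \<gamma>"
    using assms(2-)
  proof (induction i arbitrary: r)
    case 0
    then show ?case by simp
  next
    case (Suc i)
    show ?case
    proof (cases "k = i")
      case False
      then show ?thesis using Suc by auto
    next
      case True
      define n where "n = \<lfloor>y $ e k / \<gamma>\<rfloor>"
      have n: "real_of_int n * \<gamma> \<le> y $ e k" "y $ e k < real_of_int (n + 1) * \<gamma>"
        using assms(1) unfolding n_def
        by (simp_all add: pos_le_divide_eq[symmetric] pos_divide_less_eq[symmetric])
      have "- real H \<le> y $ e k / \<gamma>" "y $ e k / \<gamma> < real H"
        using assms(1) Suc.prems by (auto simp: field_simps)
      \<comment> \<open>The strict upper bound on \<open>y $ e k\<close> gives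
        \<open>n < int H\<close>, so that \<open>n + 1\<close> is still the index of a grid
        point.\<close>
      then have nH: "- int H \<le> n" "n < int H"
        unfolding n_def by (auto simp: le_floor_iff floor_less_iff)
      define a b where "a = x i (r div N) (r mod N)" and "b = x i (r div N) (Suc (r mod N))"
      have yw: "a \<le> ereal (y $ e k)" "ereal (y $ e k) < b" "a \<le> ereal (w $ e k)" "ereal (w $ e k) < b"
        using Suc.prems True by (auto simp: a_def b_def)
      have nohit: "\<not> (a \<le> ereal (real_of_int m * \<gamma>) \<and> ereal (real_of_int m * \<gamma>) < b)"
        if "- int H \<le> m" "m \<le> int H" for m
        using Suc.prems(1) that by (auto simp: a_def b_def grid_points_def)
      have 1: "real_of_int n * \<gamma> \<le> w $ e k"
      proof (rule ccontr)
        assume "\<not> real_of_int n * \<gamma> \<le> w $ e k"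
        then have "a \<le> ereal (real_of_int n * \<gamma>)" "ereal (real_of_int n * \<gamma>) < b"
          using yw(3) order_trans[of a "ereal (w $ e k)"] le_less_trans[OF _ yw(2)] n by auto
        then show False using nohit[of n] nH by auto
      qed
      have 2: "w $ e k < real_of_int (n + 1) * \<gamma>"
      proof (rule ccontr)
        assume "\<not> w $ e k < real_of_int (n + 1) * \<gamma>"
        then have "ereal (real_of_int (n+1) * \<gamma>) < b" "a \<le> ereal (real_of_int (n+1) * \<gamma>)"
          using yw(1) order_trans[of a "ereal (y $ e k)"] le_less_trans[OF _ yw(4)] n by auto
        then show False using nohit[of "n+1"] nH by auto
      qed
      have "- real H * \<gamma> \<le> real_of_int n * \<gamma>"
        using nH assms(1) by (intro mult_right_mono) linarith+
      moreover have "real_of_int (n + 1) * \<gamma> \<le> real H * \<gamma>"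
        using nH assms(1) by (intro mult_right_mono) linarith+
      ultimately show ?thesis using 1 2 n by (auto simp: algebra_simps abs_if)
    qed
  qed
  then show "\<bar>y $ e k - w $ e k\<bar> \<le> \<gamma>" "- (real H * \<gamma>) \<le> w $ e k" "w $ e k \<le> real H * \<gamma>" by auto
qed

subsection \<open>Partitions into cells of equal mass\<close>

text \<open>The marginal in coordinate \<open>k\<close> of \<mu> restricted to \<open>C\<close> has
  no atoms, so its distribution function is continuous. The intermediate value theorem yields the
  quantiles at the levels \<open>l / L\<close>, which serve as inner cuts.\<close>

lemma ex_quantile_split:
  fixes \<mu> :: "(real ^ 'd::finite) measure"
  assumes "finite_measure \<mu>" and sets: "sets \<mu> = sets borel"
    and null: "\<And>t. measure \<mu> {y. y $ k = t} = 0"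
    and C: "C \<in> sets borel" "measure \<mu> C > 0" and L: "L > 0"
  shows "\<exists>c. c 0 = -\<infinity> \<and> c L = (\<infinity>::ereal) \<and> strict_mono_on {..L} c \<and>
    (\<forall>l<L. measure \<mu> (C \<inter> {y. c l \<le> ereal (y $ k) \<and> ereal (y $ k) < c (Suc l)}) = measure \<mu> C / L)"
proof -
  interpret finite_measure \<mu> by fact
  note [measurable_cong] = sets
  have [measurable]: "C \<in> sets \<mu>" using C sets by simp
  have space: "space \<mu> = UNIV" using sets_eq_imp_space_eq[OF sets] by simp
  define m where "m = measure \<mu> C"
  define \<nu> where "\<nu> = distr (density \<mu> (indicator C)) borel (\<lambda>y. y $ k)"
  have em: "emeasure \<nu> B = emeasure \<mu> (C \<inter> {y. y $ k \<in> B})" if [measurable]: "B \<in> sets borel" for B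
  proof -
    have "emeasure \<nu> B = emeasure (density \<mu> (indicator C)) ((\<lambda>y. y $ k) -` B \<inter> space (density \<mu> (indicator C)))"
      unfolding \<nu>_def by (subst emeasure_distr) auto
    also have "(\<lambda>y. y $ k) -` B \<inter> space (density \<mu> (indicator C)) = {y. y $ k \<in> B}"
      by (auto simp: space)
    also have "emeasure (density \<mu> (indicator C)) {y. y $ k \<in> B} = emeasure \<mu> (C \<inter> {y. y $ k \<in> B})"
      by (rule emeasure_restricted) (use C that in \<open>auto simp: sets\<close>)
    finally show ?thesis .
  qed
  interpret \<nu>: finite_borel_measure \<nu>
  proof (intro finite_borel_measure.intro finite_borel_measure_axioms.intro finite_measureI)
    show "emeasure \<nu> (space \<nu>) \<noteq> \<infinity>" using em[of UNIV] by (simp add: \<nu>_def)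
    show "sets \<nu> = sets borel" by (simp add: \<nu>_def)
  qed
  have me: "measure \<nu> B = measure \<mu> (C \<inter> {y. y $ k \<in> B})" if "B \<in> sets borel" for B
    using em[OF that] by (simp add: measure_def)
  have [measurable]: "{y. y $ k \<in> B} \<in> sets \<mu>" if "B \<in> sets borel" for B
    using that by (simp add: sets)
  have atom: "measure \<nu> {t} = 0" for t
  proof -
    have "measure \<nu> {t} \<le> measure \<mu> {y. y $ k \<in> {t}}" by (subst me) (auto intro!: finite_measure_mono)
    then show ?thesis using null[of t] measure_nonneg[of \<nu> "{t}"] by simp
  qed
  have cont: "isCont (cdf \<nu>) t" for t using \<nu>.isCont_cdf atom by simp
  have tot: "measure \<nu> (space \<nu>) = m" using me[of UNIV] by (simp add: \<nu>_def m_def)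
  have "\<exists>t. cdf \<nu> t = real l * m / L" if l: "0 < l" "l < L" for l
  proof -
    have v: "0 < real l * m / L" "real l * m / L < m"
      using l C by (auto simp: m_def field_simps)
    obtain a where a: "cdf \<nu> a < real l * m / L"
      using eventually_happens[OF order_tendstoD(2)[OF \<nu>.cdf_lim_at_bot v(1)]] by auto
    obtain b where b: "cdf \<nu> b > real l * m / L"
      using eventually_happens[OF order_tendstoD(1)[OF \<nu>.cdf_lim_at_top, unfolded tot, OF v(2)]] by auto
    have "a \<le> b" using \<nu>.cdf_nondecreasing[of b a] a b by linarith
    then obtain t where "cdf \<nu> t = real l * m / L"
      using IVT[of "cdf \<nu>" a "real l * m / L" b] a b cont by auto
    then show ?thesis ..
  qed
  then obtain t where t: "\<And>l. 0 < l \<Longrightarrow> l < L \<Longrightarrow> cdf \<nu> (t l) = real l * m / L" by metis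
  define c where "c l = (if l = 0 then -\<infinity> else if l = L then \<infinity> else ereal (t l))" for l
  have mono: "strict_mono_on {..L} c"
  proof (rule strict_mono_onI)
    fix l l' assume l: "l \<in> {..L}" "l' \<in> {..L}" "l < l'"
    have "t l < t l'" if "l > 0" "l' < L"
    proof (rule ccontr)
      assume "\<not> t l < t l'"
      then have "cdf \<nu> (t l') \<le> cdf \<nu> (t l)" by (intro \<nu>.cdf_nondecreasing) simp
      then have "real l' * m / L \<le> real l * m / L" using t l that by simp
      then show False using l L C by (auto simp: field_simps m_def)
    qed
    then show "c l < c l'" using l by (auto simp: c_def)
  qed
  \<comment> \<open>Half-lines below the cuts treat the infinite outer cuts on a par with the
    quantiles; every slab is a difference of two of them.\<close>
  define B where "B l = {s. ereal s < c l}" for l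
  have Bm [measurable]: "B l \<in> sets borel" for l unfolding B_def by measurable
  have B: "measure \<nu> (B l) = real l * m / L" if "l \<le> L" for l
  proof -
    consider "l = 0" | "l = L" | "0 < l" "l < L" using \<open>l \<le> L\<close> by linarith
    then show ?thesis
    proof cases
      case 1
      then show ?thesis by (simp add: B_def c_def)
    next
      case 2
      then have "B l = space \<nu>" using L by (auto simp: B_def c_def \<nu>_def)
      then show ?thesis using tot 2 L by simp
    next
      case 3
      \<comment> \<open>The distribution function measures closed half-lines; removing the end point
        costs nothing because it is no atom.\<close>
      then have "B l = {..t l} - {t l}" by (auto simp: B_def c_def)
      then have "measure \<nu> (B l) = cdf \<nu> (t l)"
        using \<nu>.finite_measure_Diff[of "{..t l}" "{t l}"] atom by (simp add: cdf_def \<nu>.M_is_borel)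
      then show ?thesis using t 3 by simp
    qed
  qed
  have "measure \<mu> (C \<inter> {y. c l \<le> ereal (y $ k) \<and> ereal (y $ k) < c (Suc l)}) = m / L" if l: "l < L" for l
  proof -
    have "c l < c (Suc l)" using l by (intro strict_mono_onD[OF mono]) auto
    then have sub: "B l \<subseteq> B (Suc l)" by (auto simp: B_def)
    have "measure \<mu> (C \<inter> {y. c l \<le> ereal (y $ k) \<and> ereal (y $ k) < c (Suc l)}) = measure \<nu> (B (Suc l) - B l)"
      by (subst me) (auto simp: B_def not_less intro!: arg_cong[where f = "measure \<mu>"])
    also have "\<dots> = measure \<nu> (B (Suc l)) - measure \<nu> (B l)"
      using sub by (intro \<nu>.finite_measure_Diff) auto
    also have "\<dots> = m / L" using B l L by (simp add: field_simps)
    finally show ?thesis .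
  qed
  then show ?thesis using mono L by (intro exI[of _ c]) (auto simp: c_def m_def)
qed

text \<open>\<open>gessaman_cell\<close> expects all cuts in advance, but a quantile cut can only be
  chosen once its cell is known. Here \<open>c\<close> turns a cell, given as a set, into its cuts,
  so cells and cuts are built together; the cuts can be read off afterwards.\<close>

primrec split_cell ::
  "(nat \<Rightarrow> 'd::finite) \<Rightarrow> nat \<Rightarrow> ((real ^ 'd) set \<Rightarrow> 'd \<Rightarrow> nat \<Rightarrow> ereal) \<Rightarrow> nat \<Rightarrow> nat \<Rightarrow> (real ^ 'd) set"
where
  "split_cell e L c 0 r = UNIV"
| "split_cell e L c (Suc i) r = (let C = split_cell e L c i (r div L) in
     C \<inter> {y. c C (e i) (r mod L) \<le> ereal (y $ e i) \<and> ereal (y $ e i) < c C (e i) (Suc (r mod L))})"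

lemma gessaman_cell_eq_split_cell:
  "gessaman_cell e L (\<lambda>i j. c (split_cell e L c i j) (e i)) i r = split_cell e L c i r"
  by (induction i arbitrary: r) (simp_all add: Let_def)

text \<open>Each stage divides the mass of a cell by \<open>L\<close>, so every cell keeps positive
  mass and can be split again. The same \<open>x\<close> serves every depth
  \<open>d\<close>.\<close>

lemma ex_quantile_cuts:
  fixes \<mu> :: "(real ^ 'd::finite) measure"
  assumes "prob_space \<mu>" and sets: "sets \<mu> = sets borel"
    and null: "\<And>k t. measure \<mu> {y. y $ k = t} = 0" and L: "L > 0"
  shows "\<exists>x. (\<forall>d. cut_structure d L x) \<and>
    (\<forall>i. \<forall>q<L ^ i. measure \<mu> (gessaman_cell e L x i q) = 1 / real L ^ i)"
proof -
  interpret prob_space \<mu> by fact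
  define Q where "Q C k c \<longleftrightarrow> c 0 = -\<infinity> \<and> c L = (\<infinity>::ereal) \<and> strict_mono_on {..L} c \<and>
    (\<forall>l<L. measure \<mu> (C \<inter> {y. c l \<le> ereal (y $ k) \<and> ereal (y $ k) < c (Suc l)}) = measure \<mu> C / L)"
    for C and k :: 'd and c
  define c where "c C k = (SOME c. Q C k c)" for C k
  have c: "Q C k (c C k)" if "C \<in> sets borel" "measure \<mu> C > 0" for C k
  proof -
    have "\<exists>c. Q C k c"
      using ex_quantile_split[OF finite_measure_axioms sets null that L, of k] by (simp add: Q_def)
    then show ?thesis unfolding c_def by (rule someI_ex)
  qed
  define x where "x i j = c (split_cell e L c i j) (e i)" for i j
  have x: "gessaman_cell e L x i r = split_cell e L c i r" for i r
    using gessaman_cell_eq_split_cell[of e L c] by (simp add: x_def[abs_def])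
  have meas: "measure \<mu> (gessaman_cell e L x i q) = 1 / real L ^ i" if "q < L ^ i" for i q
    using that
  proof (induction i arbitrary: q)
    case 0
    then show ?case using prob_space sets_eq_imp_space_eq[OF sets] by simp
  next
    case (Suc i)
    note q = div_less_power[OF Suc.prems]
    have m: "measure \<mu> (gessaman_cell e L x i (q div L)) = 1 / real L ^ i" by (rule Suc.IH) fact
    have "Q (gessaman_cell e L x i (q div L)) (e i) (x i (q div L))"
      unfolding x_def[of i] x[symmetric] using m L by (intro c sets_gessaman_cell) simp
    then show ?case using q m by (simp add: Q_def)
  qed
  have "cut_structure d L x" for d
    unfolding cut_structure_def
  proof (intro allI impI)
    fix i j assume "i < d" "j < L ^ i"
    then have "Q (gessaman_cell e L x i j) (e i) (x i j)"
      unfolding x_def[of i] x[symmetric] using meas L by (intro c sets_gessaman_cell) simp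
    then show "x i j 0 = -\<infinity> \<and> x i j L = \<infinity> \<and> strict_mono_on {..L} (x i j)" by (simp add: Q_def)
  qed
  with meas show ?thesis by blast
qed

subsection \<open>Uniform deviations over finite families of sets\<close>

definition empirical :: "nat \<Rightarrow> (nat \<Rightarrow> 'a) \<Rightarrow> 'a set \<Rightarrow> real" where
  "empirical M s S = real (card {m. m < M \<and> s m \<in> S}) / real M"

lemma empirical_mono: "S \<subseteq> S' \<Longrightarrow> empirical M s S \<le> empirical M s S'"
  unfolding empirical_def by (intro divide_right_mono of_nat_mono card_mono) auto

lemma empirical_UN_disjoint:
  assumes "finite I" "disjoint_family_on S I"
  shows "empirical M s (\<Union>i\<in>I. S i) = (\<Sum>i\<in>I. empirical M s (S i))"
proof -
  have "{m. m < M \<and> s m \<in> (\<Union>i\<in>I. S i)} = (\<Union>i\<in>I. {m. m < M \<and> s m \<in> S i})" by auto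
  also have "card \<dots> = (\<Sum>i\<in>I. card {m. m < M \<and> s m \<in> S i})"
    using assms by (intro card_UN_disjoint) (auto simp: disjoint_family_on_def)
  finally show ?thesis unfolding empirical_def by (simp add: sum_divide_distrib)
qed

lemma empirical_eq_sum: "empirical M s S = (\<Sum>m<M. indicator S (s m)) / real M"
proof -
  have "{m. m < M \<and> s m \<in> S} = {m\<in>{..<M}. s m \<in> S}" by auto
  then show ?thesis by (simp add: empirical_def indicator_def of_bool_def sum.If_cases Int_def)
qed

context prob_space
begin

text \<open>One-sided Hoeffding inequality for the i.i.d. indicators of \<open>S\<close>, which take
  values between 0 and 1 and have mean \<open>measure \<mu> S\<close>.\<close>

lemma prob_empirical_ge_le:
  fixes Y :: "nat \<Rightarrow> 'a \<Rightarrow> 'b::topological_space"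
  assumes indep: "indep_vars (\<lambda>_. borel) Y UNIV" and distr: "\<And>m. distr M borel (Y m) = \<mu>"
    and S [measurable]: "S \<in> sets borel" and "n > 0" "\<epsilon> \<ge> 0"
  shows "prob {\<omega>\<in>space M. empirical n (\<lambda>m. Y m \<omega>) S \<ge> measure \<mu> S + \<epsilon>} \<le> exp (- 2 * real n * \<epsilon>\<^sup>2)"
proof -
  have Y [measurable]: "Y m \<in> borel_measurable M" for m
    using indep by (auto simp: indep_vars_def)
  interpret Hoeffding_ineq_iid M "{..<n}" "\<lambda>m \<omega>. indicator S (Y m \<omega>)" "\<lambda>\<omega>. indicator S (Y 0 \<omega>)" 0 1
    "expectation (\<lambda>\<omega>. indicator S (Y 0 \<omega>))"
  proof unfold_locales
    have "indep_vars (\<lambda>_. borel) Y {..<n}" by (rule indep_vars_subset[OF indep]) auto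
    then show "indep_vars (\<lambda>_. borel) (\<lambda>m \<omega>. indicator S (Y m \<omega>)) {..<n}"
      by (rule indep_vars_compose2) simp
    have "distr M borel (\<lambda>\<omega>. indicator S (Y m \<omega>)) = distr \<mu> borel (indicator S :: _ \<Rightarrow> real)" for m
      unfolding distr[of m, symmetric] by (subst distr_distr) (auto simp: comp_def)
    then show "distr M borel (\<lambda>\<omega>. indicator S (Y m \<omega>)) = distr M borel (\<lambda>\<omega>. indicator S (Y 0 \<omega>) :: real)" for m
      by simp
  qed (auto simp: indicator_def)
  have "expectation (\<lambda>\<omega>. indicat_real S (Y 0 \<omega>)) = (\<integral>x. indicator S x \<partial>distr M borel (Y 0))"
    by (rule integral_distr[of "Y 0" M borel "indicator S :: _ \<Rightarrow> real", symmetric]) auto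
  also have "\<dots> = measure \<mu> S" unfolding distr using distr[of 0] by (auto simp: S)
  finally have mean: "expectation (\<lambda>\<omega>. indicat_real S (Y 0 \<omega>)) = measure \<mu> S" .
  have "prob {\<omega>\<in>space M. (\<Sum>m\<in>{..<n}. indicat_real S (Y m \<omega>)) / real (card {..<n})
      \<ge> expectation (\<lambda>\<omega>. indicat_real S (Y 0 \<omega>)) + \<epsilon>}
    \<le> exp (- 2 * real (card {..<n}) * \<epsilon>\<^sup>2 / (1 - 0)\<^sup>2)"
    by (rule Hoeffding_ineq_ge'[OF \<open>\<epsilon> \<ge> 0\<close>]) (use \<open>n > 0\<close> in auto)
  then show ?thesis unfolding mean empirical_eq_sum by simp
qed

text \<open>The cells \<open>Q n q\<close> do not depend on the sample, so for each \<open>n\<close>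
  only \<open>2 ^ L n\<close> fixed events have to be excluded. A union bound gives summable
  probabilities, and Borel-Cantelli applies.\<close>

lemma AE_uniform_deviation:
  fixes Y :: "nat \<Rightarrow> 'a \<Rightarrow> 'b::topological_space"
  assumes indep: "indep_vars (\<lambda>_. borel) Y UNIV" and distr: "\<And>m. distr M borel (Y m) = \<mu>"
    and Q [measurable]: "\<And>n q. Q n q \<in> sets borel" and "\<epsilon> > 0"
    and small: "\<forall>\<^sub>F n in inf at_top (principal A). real (L n) \<le> \<epsilon>\<^sup>2 * real n"
  shows "AE \<omega> in M. \<forall>\<^sub>F n in inf at_top (principal A).
    \<forall>I\<subseteq>{..<L n}. empirical n (\<lambda>m. Y m \<omega>) (\<Union>q\<in>I. Q n q) \<le> measure \<mu> (\<Union>q\<in>I. Q n q) + \<epsilon>"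
proof -
  have Y [measurable]: "Y m \<in> borel_measurable M" for m
    using indep by (auto simp: indep_vars_def)
  define U where "U n I = (\<Union>q\<in>I. Q n q)" for n I
  have U [measurable]: "U n I \<in> sets borel" for n I
    unfolding U_def using Q by (intro sets.countable_UN') auto
  define E where "E n I = {\<omega>\<in>space M. empirical n (\<lambda>m. Y m \<omega>) (U n I) \<ge> measure \<mu> (U n I) + \<epsilon>}" for n I
  have E [measurable]: "E n I \<in> sets M" for n I
    unfolding E_def empirical_eq_sum by measurable
  \<comment> \<open>Setting \<open>B n\<close> to be empty where \<open>L n\<close> is too large
    makes the geometric bound hold for every \<open>n\<close>, so Borel-Cantelli can run over the
    full sequence and the restriction to \<open>A\<close> comes afterwards.\<close>
  define B where "B n = (if real (L n) \<le> \<epsilon>\<^sup>2 * real n \<and> n > 0 then (\<Union>I\<in>Pow {..<L n}. E n I) else {})" for n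
  have B [measurable]: "B n \<in> sets M" for n
    unfolding B_def using E by (auto intro!: sets.finite_UN)
  have "prob (B n) \<le> exp (- \<epsilon>\<^sup>2) ^ n" for n
  proof (cases "real (L n) \<le> \<epsilon>\<^sup>2 * real n \<and> n > 0")
    case True
    then have "prob (B n) = prob (\<Union>I\<in>Pow {..<L n}. E n I)" by (simp add: B_def)
    also have "\<dots> \<le> (\<Sum>I\<in>Pow {..<L n}. prob (E n I))"
      using E by (intro finite_measure_subadditive_finite) auto
    also have "\<dots> \<le> (\<Sum>I\<in>Pow {..<L n}. exp (- 2 * real n * \<epsilon>\<^sup>2))"
      unfolding E_def using True \<open>\<epsilon> > 0\<close> U
      by (intro sum_mono prob_empirical_ge_le[OF indep distr]) auto
    also have "\<dots> = 2 ^ L n * exp (- 2 * real n * \<epsilon>\<^sup>2)" by (simp add: card_Pow)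
    \<comment> \<open>Since \<open>2 \<le> exp 1\<close>, the number of unions is at most
      \<open>exp (L n)\<close>; with \<open>L n \<le> \<epsilon>\<^sup>2 * n\<close>, half of
      Hoeffding's exponent survives.\<close>
    also have "\<dots> \<le> exp 1 ^ L n * exp (- 2 * real n * \<epsilon>\<^sup>2)"
      using exp_ge_add_one_self[of 1] by (intro mult_right_mono power_mono) auto
    also have "\<dots> = exp (real (L n) - 2 * real n * \<epsilon>\<^sup>2)"
      by (simp add: exp_of_nat_mult[symmetric] exp_add[symmetric])
    also have "\<dots> \<le> exp (real n * (- \<epsilon>\<^sup>2))" using True by (simp add: algebra_simps)
    also have "\<dots> = exp (- \<epsilon>\<^sup>2) ^ n" by (rule exp_of_nat_mult)
    finally show ?thesis .
  next
    case False
    then have "B n = {}" by (auto simp: B_def)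
    then show ?thesis by simp
  qed
  then have "summable (\<lambda>n. prob (B n))"
    using \<open>\<epsilon> > 0\<close> by (intro summable_comparison_test'[where N = 0, OF summable_geometric[of "exp (- \<epsilon>\<^sup>2)"]]) auto
  then have "AE \<omega> in M. \<forall>\<^sub>F n in sequentially. \<omega> \<in> space M - B n"
    by (intro borel_cantelli_AE1) (auto simp: emeasure_eq_measure)
  then show ?thesis
  proof (rule eventually_mono)
    fix \<omega> assume "\<forall>\<^sub>F n in sequentially. \<omega> \<in> space M - B n"
    then have "\<forall>\<^sub>F n in inf at_top (principal A). \<omega> \<in> space M - B n \<and> n > 0"
      using eventually_gt_at_top[of "0::nat"] by (auto simp: eventually_inf_principal elim!: eventually_elim2)
    then show "\<forall>\<^sub>F n in inf at_top (principal A).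
      \<forall>I\<subseteq>{..<L n}. empirical n (\<lambda>m. Y m \<omega>) (\<Union>q\<in>I. Q n q) \<le> measure \<mu> (\<Union>q\<in>I. Q n q) + \<epsilon>"
      using small
    proof eventually_elim
      case (elim n)
      show ?case
      proof (intro allI impI)
        fix I assume "I \<subseteq> {..<L n}"
        with elim have "\<omega> \<notin> E n I" "\<omega> \<in> space M" by (auto simp: B_def)
        then have "empirical n (\<lambda>m. Y m \<omega>) (U n I) \<le> measure \<mu> (U n I) + \<epsilon>" by (simp add: E_def)
        then show "empirical n (\<lambda>m. Y m \<omega>) (\<Union>q\<in>I. Q n q) \<le> measure \<mu> (\<Union>q\<in>I. Q n q) + \<epsilon>"
          by (simp add: U_def)
      qed
    qed
  qed
qed

end

section \<open>Masses of the cells of a data-dependent partition\<close>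

text \<open>Let \<open>U\<close> be the union of the cells of too small mass and \<open>S\<close>
  the union of the quantile cells that meet \<open>U\<close>. The empirical mass of
  \<open>U\<close>, known exactly, is at most that of \<open>S\<close>, hence at most
  \<open>measure \<mu> S + \<epsilon>\<close>; and \<open>S\<close> exceeds \<open>U\<close> only by
  hit quantile cells, of mass at most \<open>d / K\<close>.\<close>

lemma cell_mass_deviation_le:
  fixes \<mu> :: "(real ^ 'd::finite) measure"
  assumes "prob_space \<mu>" and sets: "sets \<mu> = sets borel"
    and x: "cut_structure d N x" and z: "cut_structure d (K * N) z" and pos: "N > 0" "K > 0"
    and zmass: "\<And>q. q < (K * N) ^ d \<Longrightarrow> measure \<mu> (gessaman_cell e (K * N) z d q) = 1 / real (K * N) ^ d"
    and emp: "\<And>r. r < N ^ d \<Longrightarrow> empirical M s (gessaman_cell e N x d r) = 1 / real N ^ d"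
    and dev: "\<And>I. I \<subseteq> {..<(K * N) ^ d} \<Longrightarrow>
      empirical M s (\<Union>q\<in>I. gessaman_cell e (K * N) z d q)
        \<le> measure \<mu> (\<Union>q\<in>I. gessaman_cell e (K * N) z d q) + \<epsilon>"
  shows "(\<Sum>r<N ^ d. \<bar>1 / real N ^ d - measure \<mu> (gessaman_cell e N x d r)\<bar>) \<le> 2 * (\<epsilon> + real d / real K)"
proof -
  interpret prob_space \<mu> by fact
  define L where "L = K * N"
  define R where "R = gessaman_cell e N x d"
  define Q where "Q = gessaman_cell e L z d"
  have RQ [measurable]: "R r \<in> sets \<mu>" "Q r \<in> sets \<mu>" for r
    unfolding R_def Q_def sets by (rule sets_gessaman_cell)+
  have Rdisj: "disjoint_family_on R {..<N ^ d}" and Rcov: "(\<Union>r<N ^ d. R r) = UNIV"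
    unfolding R_def using gessaman_cell_disjoint[OF x order_refl] gessaman_cell_cover[OF x order_refl] by blast+
  have Qcov: "(\<Union>q<L ^ d. Q q) = UNIV" unfolding Q_def L_def using gessaman_cell_cover[OF z order_refl] by blast
  have UN: "measure \<mu> (\<Union>r\<in>I. R r) = (\<Sum>r\<in>I. measure \<mu> (R r))" if "I \<subseteq> {..<N ^ d}" for I
    using that Rdisj finite_subset[OF that]
    by (intro finite_measure_finite_Union) (auto simp: disjoint_family_on_def)
  define B where "B = {q. q < L ^ d \<and> hit L z (interior_cuts e N x L z) d q}"
  \<comment> \<open>Each cell of the coarse partition offers at most \<open>N\<close> cuts, so the
    hit fraction is at most \<open>d * N / L\<close>, which is \<open>d / K\<close>.\<close>
  have "L * card B \<le> d * N * L ^ d"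
    unfolding B_def L_def using finite_interior_cuts card_interior_cuts_le
    by (intro card_hit_le[OF z]) auto
  then have "real L * real (card B) \<le> real d * real N * real L ^ d"
    by (metis (mono_tags) of_nat_le_iff of_nat_mult of_nat_power)
  then have "real (card B) / real L ^ d \<le> real d / real K"
    using pos by (simp add: field_simps L_def)
  moreover have "measure \<mu> (\<Union>q\<in>B. Q q) \<le> (\<Sum>q\<in>B. measure \<mu> (Q q))"
    by (intro finite_measure_subadditive_finite) (auto simp: B_def)
  moreover have "(\<Sum>q\<in>B. measure \<mu> (Q q)) = (\<Sum>q\<in>B. 1 / real L ^ d)"
    using zmass by (intro sum.cong) (auto simp: B_def Q_def L_def)
  ultimately have B: "measure \<mu> (\<Union>q\<in>B. Q q) \<le> real d / real K" by simp
  \<comment> \<open>Both sums of masses are \<open>1\<close>, so it suffices to control the positive parts, on the cells in \<open>I\<close>.\<close>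
  define I where "I = {r. r < N ^ d \<and> measure \<mu> (R r) < 1 / real N ^ d}"
  define U where "U = (\<Union>r\<in>I. R r)"
  define I' where "I' = {q. q < L ^ d \<and> Q q \<inter> U \<noteq> {}}"
  define S where "S = (\<Union>q\<in>I'. Q q)"
  have [measurable]: "U \<in> sets \<mu>" unfolding U_def I_def by (auto intro!: sets.finite_UN)
  have "U \<subseteq> S" using Qcov unfolding S_def I'_def by blast
  \<comment> \<open>A quantile cell that is not hit lies in a single cell \<open>r'\<close>; as it
    meets the cell \<open>r\<close> in \<open>I\<close>, disjointness identifies the two.\<close>
  have "Q q \<subseteq> U \<union> (\<Union>q\<in>B. Q q)" if q: "q \<in> I'" for q
  proof (cases "q \<in> B")
    case False
    obtain y r where y: "y \<in> Q q" "r \<in> I" "y \<in> R r" and qL: "q < L ^ d"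
      using q by (auto simp: I'_def U_def)
    obtain r' where r': "r' < N ^ d" "Q q \<subseteq> R r'"
      using not_hit_imp_subset_cell[OF x z order_refl, of q e] False qL
      unfolding B_def L_def Q_def R_def by auto
    have "r' = r"
      using Rdisj y r' unfolding disjoint_family_on_def I_def by blast
    then show ?thesis using r' y by (auto simp: U_def)
  qed auto
  then have "S \<subseteq> U \<union> (\<Union>q\<in>B. Q q)" unfolding S_def by blast
  then have "measure \<mu> S \<le> measure \<mu> (U \<union> (\<Union>q\<in>B. Q q))"
    by (intro finite_measure_mono) (auto simp: B_def)
  also have "\<dots> \<le> measure \<mu> U + measure \<mu> (\<Union>q\<in>B. Q q)"
    by (intro measure_Un_le) (auto simp: B_def)
  finally have S: "measure \<mu> S \<le> measure \<mu> U + real d / real K" using B by simp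
  have "real (card I) / real N ^ d = empirical M s U"
  proof -
    have "empirical M s U = (\<Sum>r\<in>I. empirical M s (R r))"
      unfolding U_def using Rdisj by (intro empirical_UN_disjoint) (auto simp: I_def disjoint_family_on_def)
    also have "\<dots> = (\<Sum>r\<in>I. 1 / real N ^ d)"
      using emp by (intro sum.cong) (auto simp: I_def R_def)
    finally show ?thesis by simp
  qed
  also have "\<dots> \<le> empirical M s S" by (rule empirical_mono) fact
  \<comment> \<open>The index set \<open>I'\<close> may depend on the sample, but \<open>S\<close>
    is one of the finitely many unions that \<open>dev\<close> controls simultaneously.\<close>
  also have "\<dots> \<le> measure \<mu> S + \<epsilon>"
    using dev[of I'] unfolding S_def Q_def L_def I'_def by auto
  finally have main: "real (card I) / real N ^ d - measure \<mu> U \<le> \<epsilon> + real d / real K" using S by simp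
  have total: "(\<Sum>r<N ^ d. 1 / real N ^ d - measure \<mu> (R r)) = 0"
    using UN[of "{..<N ^ d}"] Rcov prob_space sets_eq_imp_space_eq[OF sets] pos
    by (simp add: sum_subtractf)
  have "\<bar>t\<bar> = 2 * (if t > 0 then t else 0) - t" for t :: real by simp
  then have "(\<Sum>r<N ^ d. \<bar>1 / real N ^ d - measure \<mu> (R r)\<bar>) =
      2 * (\<Sum>r<N ^ d. if 1 / real N ^ d - measure \<mu> (R r) > 0 then 1 / real N ^ d - measure \<mu> (R r) else 0)"
    using total by (simp only: sum_subtractf sum_distrib_left[symmetric])
  also have "(\<Sum>r<N ^ d. if 1 / real N ^ d - measure \<mu> (R r) > 0 then 1 / real N ^ d - measure \<mu> (R r) else 0)
      = (\<Sum>r\<in>I. 1 / real N ^ d - measure \<mu> (R r))"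
    by (subst sum.inter_filter[symmetric]) (auto simp: I_def intro!: sum.cong)
  also have "\<dots> = real (card I) / real N ^ d - measure \<mu> U"
    unfolding U_def by (subst UN) (auto simp: sum_subtractf I_def)
  finally show ?thesis using main unfolding R_def by simp
qed

text \<open>Hit cells are controlled by counting: there are few of them, and each has mass
  \<open>1 / N ^ d\<close> up to its deviation. The remaining bad cells are disjoint and miss
  \<open>B\<close>, so together they carry at most the mass of its complement.\<close>

lemma sum_bad_cell_mass_le:
  fixes \<mu> :: "(real ^ 'd::finite) measure"
  assumes "prob_space \<mu>" and sets: "sets \<mu> = sets borel"
    and x: "cut_structure d N x" and pos: "N > 0" and B: "B \<in> sets borel"
    and bad: "\<And>r. r \<in> I \<Longrightarrow> r < N ^ d \<and>
      (hit N x (\<lambda>_ _. grid_points H \<gamma>) d r \<or> gessaman_cell e N x d r \<inter> B = {})"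
  shows "(\<Sum>r\<in>I. measure \<mu> (gessaman_cell e N x d r)) \<le> real (d * (2 * H + 1)) / real N +
    (\<Sum>r<N ^ d. \<bar>1 / real N ^ d - measure \<mu> (gessaman_cell e N x d r)\<bar>) + measure \<mu> (- B)"
proof -
  interpret prob_space \<mu> by fact
  define R where "R = gessaman_cell e N x d"
  have R [measurable]: "R r \<in> sets \<mu>" for r
    unfolding R_def sets by (rule sets_gessaman_cell)
  have Rdisj: "disjoint_family_on R {..<N ^ d}"
    unfolding R_def using gessaman_cell_disjoint[OF x order_refl] by blast
  define I1 where "I1 = {r. r < N ^ d \<and> hit N x (\<lambda>_ _. grid_points H \<gamma>) d r}"
  have "N * card I1 \<le> d * (2 * H + 1) * N ^ d"
    unfolding I1_def using finite_grid_points card_grid_points_le by (intro card_hit_le[OF x]) auto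
  then have "real N * real (card I1) \<le> real (d * (2 * H + 1)) * real N ^ d"
    by (metis (mono_tags) of_nat_le_iff of_nat_mult of_nat_power)
  then have c: "real (card I1) / real N ^ d \<le> real (d * (2 * H + 1)) / real N"
    using pos by (simp add: field_simps)
  have fin: "finite I" "I - I1 \<subseteq> {..<N ^ d}" using bad by (auto intro: finite_subset[of _ "{..<N ^ d}"])
  have "(\<Sum>r\<in>I. measure \<mu> (R r)) \<le> (\<Sum>r\<in>I1 \<union> (I - I1). measure \<mu> (R r))"
    using fin by (intro sum_mono2) (auto simp: I1_def)
  also have "\<dots> = (\<Sum>r\<in>I1. measure \<mu> (R r)) + (\<Sum>r\<in>I - I1. measure \<mu> (R r))"
    using fin by (intro sum.union_disjoint) (auto simp: I1_def)
  also have "(\<Sum>r\<in>I1. measure \<mu> (R r)) \<le> (\<Sum>r\<in>I1. 1 / real N ^ d + \<bar>1 / real N ^ d - measure \<mu> (R r)\<bar>)"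
    by (intro sum_mono) linarith
  also have "\<dots> = real (card I1) / real N ^ d + (\<Sum>r\<in>I1. \<bar>1 / real N ^ d - measure \<mu> (R r)\<bar>)"
    by (simp add: sum.distrib)
  also have "(\<Sum>r\<in>I1. \<bar>1 / real N ^ d - measure \<mu> (R r)\<bar>) \<le> (\<Sum>r<N ^ d. \<bar>1 / real N ^ d - measure \<mu> (R r)\<bar>)"
    by (intro sum_mono2) (auto simp: I1_def)
  also have "(\<Sum>r\<in>I - I1. measure \<mu> (R r)) = measure \<mu> (\<Union>r\<in>I - I1. R r)"
    using fin Rdisj
    by (intro finite_measure_finite_Union[symmetric]) (auto simp: disjoint_family_on_def subset_iff)
  also have "\<dots> \<le> measure \<mu> (- B)"
    using bad B by (intro finite_measure_mono) (fastforce simp: I1_def R_def sets)+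
  finally show ?thesis using c unfolding R_def by linarith
qed

subsection \<open>L1 distance between a density and a histogram\<close>

text \<open>First \<open>p\<close> is truncated at a height \<open>c\<close>; then a sequence of
  continuous functions converging to \<open>p\<close> almost everywhere is truncated at the same
  height, which keeps it continuous and dominates it on the box. Dominated convergence handles both
  steps.\<close>

lemma continuous_L1_approximation:
  fixes p :: "'a::euclidean_space \<Rightarrow> real"
  assumes p: "integrable lborel p" and "\<epsilon> > 0"
  shows "\<exists>h. continuous_on UNIV h \<and> (LINT y:cbox a b|lborel. \<bar>p y - h y\<bar>) < \<epsilon>"
proof -
  have [measurable]: "p \<in> borel_measurable borel" using p by (simp add: borel_measurable_integrable)
  define D where "D = cbox a b"
  have D [measurable]: "D \<in> sets borel" "emeasure lborel D < \<infinity>" by (auto simp: D_def emeasure_lborel_cbox_eq)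
  define clip where "clip c t = max (- c) (min c t)" for c t :: real
  have clip: "\<bar>clip c t\<bar> \<le> c" if "c \<ge> 0" for c t using that by (auto simp: clip_def)
  have [measurable]: "(\<lambda>y. clip c (p y)) \<in> borel_measurable borel" for c unfolding clip_def by measurable
  have "(\<lambda>c. LINT y:D|lborel. \<bar>p y - clip (real c) (p y)\<bar>) \<longlonglongrightarrow> (LINT y:D|lborel. 0)"
    unfolding set_lebesgue_integral_def
  proof (rule integral_dominated_convergence[where w = "\<lambda>y. \<bar>p y\<bar>"])
    show "AE y in lborel. (\<lambda>c. indicator D y *\<^sub>R \<bar>p y - clip (real c) (p y)\<bar>) \<longlonglongrightarrow> indicator D y *\<^sub>R 0"
    proof (rule AE_I2)
      fix y
      obtain n where n: "\<bar>p y\<bar> \<le> real n" using real_arch_simple by blast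
      have "clip (real c) (p y) = p y" if "c \<ge> n" for c
        using that n unfolding clip_def by auto
      then have "\<forall>\<^sub>F c in sequentially. indicator D y *\<^sub>R \<bar>p y - clip (real c) (p y)\<bar> = indicator D y *\<^sub>R 0"
        by (intro eventually_sequentiallyI[of n]) simp
      then show "(\<lambda>c. indicator D y *\<^sub>R \<bar>p y - clip (real c) (p y)\<bar>) \<longlonglongrightarrow> indicator D y *\<^sub>R 0"
        by (rule tendsto_eventually)
    qed
    show "AE y in lborel. norm (indicator D y *\<^sub>R \<bar>p y - clip (real c) (p y)\<bar>) \<le> \<bar>p y\<bar>" for c
      by (rule AE_I2) (auto simp: clip_def indicator_def)
  qed (use p in auto)
  then have "\<forall>\<^sub>F c in sequentially. (LINT y:D|lborel. \<bar>p y - clip (real c) (p y)\<bar>) < \<epsilon> / 2"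
    using \<open>\<epsilon> > 0\<close> by (intro order_tendstoD) auto
  then obtain c :: nat where c: "(LINT y:D|lborel. \<bar>p y - clip (real c) (p y)\<bar>) < \<epsilon> / 2"
    using eventually_happens[of _ sequentially] by auto
  \<comment> \<open>By its definition \<open>measurable_on\<close> provides continuous functions
    that converge to \<open>p\<close> off a negligible set.\<close>
  have "p measurable_on UNIV"
    by (intro lebesgue_measurable_imp_measurable_on_real) (auto intro: measurable_completion)
  then obtain Z g where Z: "negligible Z" and g: "\<And>n. continuous_on UNIV (g n)"
    and lim: "\<And>y. y \<notin> Z \<Longrightarrow> (\<lambda>n. g n y) \<longlonglongrightarrow> p y"
    unfolding measurable_on_def by auto
  have [measurable]: "g n \<in> borel_measurable borel" for n
    using g by (rule borel_measurable_continuous_onI)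
  have [measurable]: "(\<lambda>y. clip c (g n y)) \<in> borel_measurable borel" for n c unfolding clip_def by measurable
  have AE: "AE y in lborel. y \<notin> Z"
  proof -
    have "AE y in lebesgue. y \<notin> Z" using Z unfolding negligible_iff_null_sets by (rule AE_not_in)
    then show ?thesis by (simp only: AE_completion_iff)
  qed
  have "(\<lambda>n. LINT y:D|lborel. \<bar>clip (real c) (p y) - clip (real c) (g n y)\<bar>) \<longlonglongrightarrow> (LINT y:D|lborel. 0)"
    unfolding set_lebesgue_integral_def
  proof (rule integral_dominated_convergence[where w = "\<lambda>y. indicator D y *\<^sub>R (2 * real c)"])
    show "AE y in lborel. (\<lambda>n. indicator D y *\<^sub>R \<bar>clip (real c) (p y) - clip (real c) (g n y)\<bar>) \<longlonglongrightarrow> indicator D y *\<^sub>R 0"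
      using AE
    proof eventually_elim
      case (elim y)
      have "(\<lambda>n. indicator D y *\<^sub>R \<bar>clip (real c) (p y) - clip (real c) (g n y)\<bar>) \<longlonglongrightarrow>
        indicator D y *\<^sub>R \<bar>clip (real c) (p y) - clip (real c) (p y)\<bar>"
        unfolding clip_def by (intro tendsto_intros lim elim)
      then show ?case by simp
    qed
    show "AE y in lborel. norm (indicator D y *\<^sub>R \<bar>clip (real c) (p y) - clip (real c) (g n y)\<bar>) \<le> indicator D y *\<^sub>R (2 * real c)" for n
    proof (rule AE_I2)
      fix y
      have "\<bar>clip (real c) (p y)\<bar> \<le> real c" "\<bar>clip (real c) (g n y)\<bar> \<le> real c" by (auto intro: clip)
      then show "norm (indicator D y *\<^sub>R \<bar>clip (real c) (p y) - clip (real c) (g n y)\<bar>) \<le> indicator D y *\<^sub>R (2 * real c)"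
        by (auto simp: indicator_def)
    qed
    show "integrable lborel (\<lambda>y. indicator D y *\<^sub>R (2 * real c))" using D by (intro integrable_scaleR_left) auto
  qed auto
  then have "\<forall>\<^sub>F n in sequentially. (LINT y:D|lborel. \<bar>clip (real c) (p y) - clip (real c) (g n y)\<bar>) < \<epsilon> / 2"
    using \<open>\<epsilon> > 0\<close> by (intro order_tendstoD) auto
  then obtain n where n: "(LINT y:D|lborel. \<bar>clip (real c) (p y) - clip (real c) (g n y)\<bar>) < \<epsilon> / 2"
    using eventually_happens[of _ sequentially] by auto
  define h where "h y = clip (real c) (g n y)" for y
  have h: "continuous_on UNIV h" unfolding h_def clip_def by (intro continuous_intros g)
  have ci: "set_integrable lborel D u" if "\<And>y. \<bar>u y\<bar> \<le> real c" "u \<in> borel_measurable borel" for u :: "'a \<Rightarrow> real"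
    unfolding set_integrable_def
  proof (rule Bochner_Integration.integrable_bound)
    show "integrable lborel (\<lambda>y. indicator D y * real c)"
      using D by (intro integrable_mult_left integrable_real_indicator) auto
  qed (use that in \<open>auto simp: indicator_def\<close>)
  have ip: "set_integrable lborel D p" unfolding set_integrable_def using p by (intro integrable_mult_indicator) auto
  have i1: "set_integrable lborel D (\<lambda>y. clip (real c) (p y))"
    and i2: "set_integrable lborel D h"
    unfolding h_def by (rule ci; simp add: clip)+
  have "(LINT y:D|lborel. \<bar>p y - h y\<bar>) \<le>
    (LINT y:D|lborel. \<bar>p y - clip (real c) (p y)\<bar> + \<bar>clip (real c) (p y) - h y\<bar>)"
    by (intro set_integral_mono set_integral_add set_integrable_abs set_integral_diff ip i1 i2) auto
  also have "\<dots> = (LINT y:D|lborel. \<bar>p y - clip (real c) (p y)\<bar>) + (LINT y:D|lborel. \<bar>clip (real c) (p y) - h y\<bar>)"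
    by (intro set_integral_add set_integrable_abs set_integral_diff ip i1 i2)
  also have "\<dots> < \<epsilon>" using c n unfolding h_def by simp
  finally show ?thesis using h unfolding D_def by blast
qed

text \<open>The crude bound for bad cells: \<bar>p - a\<bar> is at most \<open>p + a\<close>, and
  \<open>a\<close> integrates to at most \<open>w\<close> over the cell.\<close>

lemma histogram_cell_bound:
  fixes p :: "'a::euclidean_space \<Rightarrow> real"
  assumes p: "integrable lborel p" "\<And>y. 0 \<le> p y" and R [measurable]: "R \<in> sets borel"
    and "w \<ge> 0"
  defines "a \<equiv> (if emeasure lborel R = \<infinity> then 0 else w / measure lborel R)"
  shows "(\<integral>\<^sup>+ y. ennreal (\<bar>p y - a\<bar> * indicator R y) \<partial>lborel) \<le> ennreal ((LINT y:R|lborel. p y) + w)"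
proof -
  have a: "a \<ge> 0" using \<open>w \<ge> 0\<close> by (simp add: a_def)
  have i1: "set_integrable lborel R p" unfolding set_integrable_def using p by (intro integrable_mult_indicator) auto
  \<comment> \<open>On a cell of infinite volume the constant \<open>a\<close> is 0, so it is
    integrable there too.\<close>
  have i2: "set_integrable lborel R (\<lambda>_. a)"
    unfolding set_integrable_def a_def by (auto simp: top.not_eq_extremum)
  have "(\<integral>\<^sup>+ y. ennreal (\<bar>p y - a\<bar> * indicator R y) \<partial>lborel) \<le> (\<integral>\<^sup>+ y. ennreal (indicator R y *\<^sub>R (p y + a)) \<partial>lborel)"
    using a p(2) by (intro nn_integral_mono ennreal_leI) (auto simp: indicator_def abs_if)
  also have "\<dots> = ennreal (LINT y:R|lborel. p y + a)"
    unfolding set_lebesgue_integral_def using set_integral_add(1)[OF i1 i2] a p(2)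
    by (intro nn_integral_eq_integral) (auto simp: set_integrable_def)
  also have "(LINT y:R|lborel. p y + a) = (LINT y:R|lborel. p y) + (LINT y:R|lborel. a)"
    by (rule set_integral_add(2)[OF i1 i2])
  also have "(LINT y:R|lborel. a) = a * measure lborel R"
    unfolding set_lebesgue_integral_def by (simp add: mult.commute)
  \<comment> \<open>The product is \<open>w\<close> for finite positive volume and 0 otherwise,
    since division by zero gives 0.\<close>
  also have "ennreal ((LINT y:R|lborel. p y) + a * measure lborel R) \<le> ennreal ((LINT y:R|lborel. p y) + w)"
    using \<open>w \<ge> 0\<close> by (intro ennreal_leI add_left_mono) (auto simp: a_def)
  finally show ?thesis .
qed

text \<open>On the cell \<open>h\<close> stays within \<eta> of its own mean, and that mean differs
  from \<open>a\<close> by the error of \<open>h\<close> against \<open>p\<close> plus the error of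
  \<open>w\<close> against the mass, divided by the volume. The integral of \<bar>p - h\<bar> enters
  a second time when \<open>p\<close> is compared with \<open>h\<close> pointwise, hence the factor
  2.\<close>

lemma histogram_small_cell_bound:
  fixes p h :: "'a::euclidean_space \<Rightarrow> real" and w :: real
  assumes p: "integrable lborel p" and R [measurable]: "R \<in> sets borel"
    and fin: "emeasure lborel R < \<infinity>" and h: "set_integrable lborel R h"
    and osc: "\<And>y z. y \<in> R \<Longrightarrow> z \<in> R \<Longrightarrow> \<bar>h y - h z\<bar> \<le> \<eta>"
  defines "a \<equiv> w / measure lborel R"
  shows "(\<integral>\<^sup>+ y. ennreal (\<bar>p y - a\<bar> * indicator R y) \<partial>lborel) \<le>
    ennreal (2 * (LINT y:R|lborel. \<bar>p y - h y\<bar>) + \<eta> * measure lborel R + \<bar>w - (LINT y:R|lborel. p y)\<bar>)"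
proof (cases "measure lborel R = 0")
  case True
  then have "R \<in> null_sets lborel"
    using fin by (auto simp: null_sets_def measure_def enn2real_eq_0_iff)
  then have "AE y in lborel. y \<notin> R" by (rule AE_not_in)
  then have "AE y in lborel. ennreal (\<bar>p y - a\<bar> * indicator R y) = 0" by eventually_elim simp
  then have "(\<integral>\<^sup>+ y. ennreal (\<bar>p y - a\<bar> * indicator R y) \<partial>lborel) = (\<integral>\<^sup>+ y. 0 \<partial>(lborel :: 'a measure))"
    by (rule nn_integral_cong_AE)
  then show ?thesis by simp
next
  case False
  define v \<delta> \<kappa> where "v = measure lborel R" and "\<delta> = (LINT y:R|lborel. \<bar>p y - h y\<bar>)"
    and "\<kappa> = \<bar>w - (LINT y:R|lborel. p y)\<bar>"
  have v: "v > 0" using False by (simp add: v_def zero_less_measure_iff)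
  have i1: "set_integrable lborel R p" unfolding set_integrable_def using p by (intro integrable_mult_indicator) auto
  have ic: "set_integrable lborel R (\<lambda>_. t)" for t :: real
    unfolding set_integrable_def using fin by (auto simp: top.not_eq_extremum)
  have c: "(LINT y:R|lborel. t) = t * v" for t :: real
    unfolding set_lebesgue_integral_def v_def by (simp add: mult.commute)
  have i2: "set_integrable lborel R (\<lambda>y. \<bar>p y - h y\<bar>)"
    by (intro set_integrable_abs set_integral_diff i1 h)
  have dev: "\<bar>h y - a\<bar> \<le> (\<kappa> + \<delta>) / v + \<eta>" if y: "y \<in> R" for y
  proof -
    \<comment> \<open>Averaging the oscillation bound over \<open>z\<close> compares
      \<open>h y\<close> with the mean of \<open>h\<close>.\<close>
    have "\<bar>LINT z:R|lborel. h y - h z\<bar> \<le> (LINT z:R|lborel. \<bar>h y - h z\<bar>)"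
      unfolding set_lebesgue_integral_def
      by (rule order_trans[OF integral_abs_bound]) (simp add: abs_mult)
    also have "\<dots> \<le> (LINT z:R|lborel. \<eta>)"
      using osc y by (intro set_integral_mono set_integrable_abs set_integral_diff ic h) auto
    finally have 1: "\<bar>h y * v - (LINT z:R|lborel. h z)\<bar> \<le> \<eta> * v"
      using set_integral_diff(2)[OF ic h, of "h y"] by (simp add: c)
    have "\<bar>LINT z:R|lborel. p z - h z\<bar> \<le> \<delta>"
      unfolding set_lebesgue_integral_def \<delta>_def
      by (rule order_trans[OF integral_abs_bound]) (simp add: abs_mult)
    then have 2: "\<bar>(LINT z:R|lborel. p z) - (LINT z:R|lborel. h z)\<bar> \<le> \<delta>"
      using set_integral_diff(2)[OF i1 h] by simp
    have "\<bar>h y - a\<bar> * v = \<bar>h y * v - w\<bar>"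
    proof -
      have "a * v = w" using v by (simp add: a_def v_def)
      then have "(h y - a) * v = h y * v - w" by (simp add: left_diff_distrib)
      then show ?thesis using v by (metis abs_mult abs_of_pos)
    qed
    also have "\<dots> \<le> \<eta> * v + \<delta> + \<kappa>" using 1 2 unfolding \<kappa>_def by linarith
    finally have "\<bar>h y - a\<bar> \<le> (\<eta> * v + \<delta> + \<kappa>) / v" using v by (simp add: pos_le_divide_eq)
    then show ?thesis using v by (simp add: add_divide_distrib)
  qed
  have nn: "0 \<le> (\<kappa> + \<delta>) / v + \<eta>" if "y \<in> R" for y using dev[OF that] by linarith
  define t where "t = (\<kappa> + \<delta>) / v + \<eta>"
  have "(\<integral>\<^sup>+ y. ennreal (\<bar>p y - a\<bar> * indicator R y) \<partial>lborel) \<le>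
      (\<integral>\<^sup>+ y. ennreal (indicator R y *\<^sub>R (\<bar>p y - h y\<bar> + t)) \<partial>lborel)"
  proof (intro nn_integral_mono ennreal_leI)
    fix y show "\<bar>p y - a\<bar> * indicator R y \<le> indicator R y *\<^sub>R (\<bar>p y - h y\<bar> + t)"
      using dev[of y] unfolding t_def by (auto simp: indicator_def)
  qed
  also have "\<dots> = ennreal (LINT y:R|lborel. \<bar>p y - h y\<bar> + t)"
    unfolding set_lebesgue_integral_def using set_integral_add(1)[OF i2 ic] nn
    by (intro nn_integral_eq_integral) (auto simp: set_integrable_def indicator_def t_def)
  also have "(LINT y:R|lborel. \<bar>p y - h y\<bar> + t) = \<delta> + t * v"
    using set_integral_add(2)[OF i2 ic] by (simp add: c \<delta>_def)
  also have "t * v = \<kappa> + \<delta> + \<eta> * v" using v by (simp add: t_def field_simps)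
  finally show ?thesis by (simp add: \<delta>_def \<kappa>_def v_def algebra_simps)
qed

text \<open>On the cells in \<open>G\<close> the fine bound is summed, on the others the crude one.
  The errors of \<open>h\<close> and the volumes of the good cells add up to at most their values on
  \<open>D\<close>, because these cells are disjoint and lie in \<open>D\<close>.\<close>

lemma histogram_L1_bound:
  fixes p h :: "'a::euclidean_space \<Rightarrow> real" and n :: nat
  assumes p: "integrable lborel p" "\<And>y. 0 \<le> p y"
    and R [measurable]: "\<And>r. R r \<in> sets borel"
    and disj: "disjoint_family_on R {..<n}" and cov: "(\<Union>r<n. R r) = UNIV"
    and D: "D \<in> sets borel" "emeasure lborel D < \<infinity>" and h: "set_integrable lborel D h"
    and "G \<subseteq> {..<n}" and small: "\<And>r. r \<in> G \<Longrightarrow> R r \<subseteq> D"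
    and osc: "\<And>r y z. r \<in> G \<Longrightarrow> y \<in> R r \<Longrightarrow> z \<in> R r \<Longrightarrow> \<bar>h y - h z\<bar> \<le> \<eta>"
    and "w \<ge> 0" "\<eta> \<ge> 0"
    and \<mu>: "\<And>r. \<mu> r = (LINT y:R r|lborel. p y)"
  defines "f \<equiv> (\<lambda>y. \<Sum>r<n. (if emeasure lborel (R r) = \<infinity> then 0 else w / measure lborel (R r)) * indicator (R r) y)"
  shows "(\<integral>\<^sup>+ y. ennreal \<bar>p y - f y\<bar> \<partial>lborel) \<le> ennreal (2 * (LINT y:D|lborel. \<bar>p y - h y\<bar>) +
    \<eta> * measure lborel D + 2 * (\<Sum>r\<in>{..<n} - G. \<mu> r) + (\<Sum>r<n. \<bar>w - \<mu> r\<bar>))"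
proof -
  have [measurable]: "p \<in> borel_measurable borel" using p(1) by (simp add: borel_measurable_integrable)
  define a where "a r = (if emeasure lborel (R r) = \<infinity> then 0 else w / measure lborel (R r))" for r
  define \<delta> where "\<delta> r = (LINT y:R r|lborel. \<bar>p y - h y\<bar>)" for r
  have \<mu>0: "\<mu> r \<ge> 0" for r unfolding \<mu> set_lebesgue_integral_def using p(2) by (intro integral_nonneg_AE) auto
  have ip: "set_integrable lborel A p" if "A \<in> sets borel" for A
    unfolding set_integrable_def using p that by (intro integrable_mult_indicator) auto
  have iD: "set_integrable lborel D (\<lambda>y. \<bar>p y - h y\<bar>)"
    by (intro set_integrable_abs set_integral_diff ip h D)
  have finG: "finite G" using \<open>G \<subseteq> {..<n}\<close> by (rule finite_subset) simp
  have disjG: "disjoint_family_on R G" using disj \<open>G \<subseteq> {..<n}\<close> by (auto simp: disjoint_family_on_def)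
  \<comment> \<open>Off \<open>G\<close> the crude bound \<open>\<mu> r + w\<close> is at most
    \<open>2 * \<mu> r + \<bar>w - \<mu> r\<bar>\<close>, which trades the weights for
    masses.\<close>
  define T where "T r = (if r \<in> G then 2 * \<delta> r + \<eta> * measure lborel (R r) else 2 * \<mu> r) + \<bar>w - \<mu> r\<bar>" for r
  have \<delta>0: "\<delta> r \<ge> 0" for r unfolding \<delta>_def set_lebesgue_integral_def by (intro integral_nonneg_AE) auto
  have T0: "T r \<ge> 0" for r using \<delta>0 \<mu>0 \<open>\<eta> \<ge> 0\<close> by (auto simp: T_def)
  have bound: "(\<integral>\<^sup>+ y. ennreal (\<bar>p y - a r\<bar> * indicator (R r) y) \<partial>lborel) \<le> ennreal (T r)" if "r < n" for r
  proof (cases "r \<in> G")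
    case True
    have fin: "emeasure lborel (R r) < \<infinity>"
      using emeasure_mono[OF small[OF True], of lborel] D by (auto intro: le_less_trans)
    have "set_integrable lborel (R r) h"
      using set_integrable_subset[OF h] small[OF True] by simp
    from histogram_small_cell_bound[OF p(1) R fin this osc[OF True], of w] True
      less_imp_neq[OF fin]
    show ?thesis by (simp add: T_def a_def \<delta>_def \<mu>)
  next
    case False
    have "(\<integral>\<^sup>+ y. ennreal (\<bar>p y - a r\<bar> * indicator (R r) y) \<partial>lborel) \<le> ennreal (\<mu> r + w)"
      using histogram_cell_bound[OF p R \<open>w \<ge> 0\<close>, of r] by (simp add: a_def \<mu>)
    also have "\<dots> \<le> ennreal (T r)" using False by (intro ennreal_leI) (auto simp: T_def)
    finally show ?thesis .
  qed
  have "ennreal \<bar>p y - f y\<bar> = (\<Sum>r<n. ennreal (\<bar>p y - a r\<bar> * indicator (R r) y))" for y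
  proof -
    obtain r where r: "r < n" "y \<in> R r" using cov by blast
    have ind: "indicator (R s) y = (if s = r then 1 else (0::real))" if "s < n" for s
      using disj r that by (auto simp: disjoint_family_on_def indicator_def)
    have "f y = (\<Sum>s<n. a s * (if s = r then 1 else 0))"
      unfolding f_def a_def using ind by (intro sum.cong) auto
    also have "\<dots> = a r" using r by (simp add: if_distrib cong: if_cong)
    finally have "f y = a r" .
    moreover have "(\<Sum>s<n. ennreal (\<bar>p y - a s\<bar> * indicator (R s) y)) =
      (\<Sum>s<n. if s = r then ennreal \<bar>p y - a r\<bar> else 0)"
      using ind by (intro sum.cong) auto
    ultimately show ?thesis using r by simp
  qed
  then have "(\<integral>\<^sup>+ y. ennreal \<bar>p y - f y\<bar> \<partial>lborel) =
      (\<integral>\<^sup>+ y. (\<Sum>r<n. ennreal (\<bar>p y - a r\<bar> * indicator (R r) y)) \<partial>lborel)"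
    by presburger
  also have "\<dots> = (\<Sum>r<n. \<integral>\<^sup>+ y. ennreal (\<bar>p y - a r\<bar> * indicator (R r) y) \<partial>lborel)"
    by (rule nn_integral_sum) measurable
  also have "\<dots> \<le> (\<Sum>r<n. ennreal (T r))" using bound by (intro sum_mono) auto
  also have "\<dots> = ennreal (\<Sum>r<n. T r)" using T0 by simp
  also have "(\<Sum>r<n. T r) = (\<Sum>r\<in>G. 2 * \<delta> r + \<eta> * measure lborel (R r)) + (\<Sum>r\<in>{..<n} - G. 2 * \<mu> r)
      + (\<Sum>r<n. \<bar>w - \<mu> r\<bar>)"
  proof -
    have "(\<Sum>r<n. if r \<in> G then 2 * \<delta> r + \<eta> * measure lborel (R r) else 2 * \<mu> r) =
      (\<Sum>r\<in>G. 2 * \<delta> r + \<eta> * measure lborel (R r)) + (\<Sum>r\<in>{..<n} - G. 2 * \<mu> r)"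
      using \<open>G \<subseteq> {..<n}\<close> by (subst sum.subset_diff[of G]) (auto simp: add.commute)
    then show ?thesis by (simp add: T_def sum.distrib)
  qed
  also have "(\<Sum>r\<in>G. 2 * \<delta> r + \<eta> * measure lborel (R r)) = 2 * (\<Sum>r\<in>G. \<delta> r) + \<eta> * (\<Sum>r\<in>G. measure lborel (R r))"
    by (simp add: sum.distrib sum_distrib_left)
  also have "(\<Sum>r\<in>G. \<delta> r) = (LINT y:(\<Union>r\<in>G. R r)|lborel. \<bar>p y - h y\<bar>)"
    unfolding \<delta>_def using finG disjG small
    by (intro set_integral_finite_Union[symmetric] set_integrable_subset[OF iD]) auto
  also have "\<dots> \<le> (LINT y:D|lborel. \<bar>p y - h y\<bar>)"
    unfolding set_lebesgue_integral_def
  proof (rule integral_mono)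
    show "integrable lborel (\<lambda>y. indicator D y *\<^sub>R \<bar>p y - h y\<bar>)"
      using iD by (simp add: set_integrable_def)
    have "set_integrable lborel (\<Union>r\<in>G. R r) (\<lambda>y. \<bar>p y - h y\<bar>)"
      by (rule set_integrable_subset[OF iD]) (use finG small in auto)
    then show "integrable lborel (\<lambda>y. indicator (\<Union>r\<in>G. R r) y *\<^sub>R \<bar>p y - h y\<bar>)"
      by (simp add: set_integrable_def)
    show "indicator (\<Union>r\<in>G. R r) y *\<^sub>R \<bar>p y - h y\<bar> \<le> indicator D y *\<^sub>R \<bar>p y - h y\<bar>" for y
      using small by (auto simp: indicator_def)
  qed
  also have "(\<Sum>r\<in>G. measure lborel (R r)) = measure lborel (\<Union>r\<in>G. R r)"
  proof (rule measure_finite_Union[symmetric])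
    show "emeasure lborel (R r) \<noteq> \<infinity>" if "r \<in> G" for r
      using le_less_trans[OF emeasure_mono[OF small[OF that], of lborel] D(2)] D(1) by auto
  qed (use finG disjG in auto)
  also have "\<dots> \<le> measure lborel D"
    using small D finG by (intro measure_mono_fmeasurable) (auto simp: fmeasurable_def)
  finally show ?thesis
    using \<open>\<eta> \<ge> 0\<close> by (simp add: sum_distrib_left mult_left_mono ennreal_leI)
qed

section \<open>From cell masses to L1 convergence\<close>

lemma hyperplane_null_density:
  assumes "f \<in> borel_measurable borel"
  shows "measure (density lborel f) {y :: real ^ 'd::finite. y $ k = t} = 0"
proof -
  have S: "{y :: real ^ 'd. y $ k = t} \<in> sets borel" by measurable
  have "{y :: real ^ 'd. y $ k = t} \<in> null_sets lebesgue"
    using negligible_hyperplane[of "axis k 1 :: real ^ 'd" t]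
    by (simp add: negligible_iff_null_sets inner_axis')
  then have "{y :: real ^ 'd. y $ k = t} \<in> null_sets lborel"
    using S by (simp add: null_sets_def)
  then have "emeasure (density lborel f) {y :: real ^ 'd. y $ k = t} = 0"
    using S assms by (simp add: emeasure_density nn_integral_null_set)
  then show ?thesis by (simp add: measure_def)
qed

lemma gessaman_estimator_eq:
  fixes e :: "nat \<Rightarrow> 'd::finite"
  shows "gessaman_estimator e N M k x = (\<lambda>y. \<Sum>r<N ^ CARD('d).
     (if emeasure lborel (gessaman_cell e N x CARD('d) r) = \<infinity> then 0
      else (real k / real M) / measure lborel (gessaman_cell e N x CARD('d) r)) *
     indicator (gessaman_cell e N x CARD('d) r) y)"
  unfolding gessaman_estimator_def Let_def divide_divide_eq_left ..

text \<open>Purely deterministic, for an arbitrary filter: once the cell masses are close to uniform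
  in total, the histogram converges. It is applied for each fixed outcome.\<close>

lemma histogram_consistent:
  fixes p :: "real ^ 'd::finite \<Rightarrow> real" and e :: "nat \<Rightarrow> 'd" and F :: "'i filter"
    and x :: "'i \<Rightarrow> nat \<Rightarrow> nat \<Rightarrow> nat \<Rightarrow> ereal"
  assumes p: "p \<in> borel_measurable borel" "\<And>y. 0 \<le> p y"
    and \<mu>_def: "\<mu> = density lborel (\<lambda>y. ennreal (p y))" and prob: "prob_space \<mu>"
    and e: "bij_betw e {..<CARD('d)} UNIV"
    and x: "\<forall>\<^sub>F M in F. cut_structure CARD('d) (N M) (x M)"
    and N: "filterlim N at_top F"
    and w: "\<forall>\<^sub>F M in F. w M \<ge> 0" "((\<lambda>M. real (N M) ^ CARD('d) * w M) \<longlongrightarrow> 1) F"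
    and mass: "((\<lambda>M. \<Sum>r<N M ^ CARD('d).
      \<bar>1 / real (N M) ^ CARD('d) - measure \<mu> (gessaman_cell e (N M) (x M) CARD('d) r)\<bar>) \<longlongrightarrow> 0) F"
  shows "((\<lambda>M. \<integral>\<^sup>+ y. ennreal \<bar>p y - (\<Sum>r<N M ^ CARD('d).
      (if emeasure lborel (gessaman_cell e (N M) (x M) CARD('d) r) = \<infinity> then 0
       else w M / measure lborel (gessaman_cell e (N M) (x M) CARD('d) r)) *
      indicator (gessaman_cell e (N M) (x M) CARD('d) r) y)\<bar> \<partial>lborel) \<longlongrightarrow> 0) F"
    (is "((\<lambda>M. ?I M) \<longlongrightarrow> 0) F")
proof -
  interpret prob_space \<mu> by fact
  note [measurable] = p(1)
  have sets [measurable_cong]: "sets \<mu> = sets borel" and space: "space \<mu> = UNIV" by (simp_all add: \<mu>_def)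
  let ?d = "CARD('d)"
  define R where "R M r = gessaman_cell e (N M) (x M) ?d r" for M r
  have R: "R M r \<in> sets borel" for M r unfolding R_def by (rule sets_gessaman_cell)
  have "(\<integral>\<^sup>+ y. ennreal (p y) \<partial>lborel) = 1"
    using emeasure_space_1 by (simp add: emeasure_density \<mu>_def)
  then have pint: "integrable lborel p" using p by (intro integrableI_nonneg) auto
  have \<mu>_integral: "measure \<mu> S = (LINT y:S|lborel. p y)" if [measurable]: "S \<in> sets borel" for S
  proof -
    have "measure \<mu> S = enn2real (\<integral>\<^sup>+ y. ennreal (indicator S y *\<^sub>R p y) \<partial>lborel)"
      unfolding measure_def \<mu>_def by (subst emeasure_density)
        (auto intro!: arg_cong[where f = enn2real] nn_integral_cong simp: indicator_def)
    also have "\<dots> = (LINT y:S|lborel. p y)"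
      unfolding set_lebesgue_integral_def using p by (intro integral_eq_nn_integral[symmetric]) auto
    finally show ?thesis .
  qed
  \<comment> \<open>Half-open, as \<open>not_hit_grid_imp_small\<close> asks for; the compact
    \<open>D\<close> chosen later is its closure.\<close>
  define box where "box b = {y :: real ^ 'd. \<forall>i. - b \<le> y $ i \<and> y $ i < b}" for b :: real
  have box [measurable]: "box b \<in> sets borel" for b unfolding box_def by measurable
  have small: "\<forall>\<^sub>F M in F. ?I M \<le> ennreal \<epsilon>" if "\<epsilon> > 0" for \<epsilon> :: real
  proof -
    have "(\<lambda>n. measure \<mu> (box (real n))) \<longlonglongrightarrow> measure \<mu> (\<Union>n. box (real n))"
    proof (rule finite_Lim_measure_incseq)
      show "range (\<lambda>n. box (real n)) \<subseteq> sets \<mu>" by (auto simp: sets box)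
      show "incseq (\<lambda>n. box (real n))"
      proof (intro incseq_SucI subsetI)
        fix n and y :: "real ^ 'd" assume "y \<in> box (real n)"
        then have "- real n \<le> y $ i \<and> y $ i < real n" for i by (simp add: box_def)
        then have "- real (Suc n) \<le> y $ i \<and> y $ i < real (Suc n)" for i by (smt (verit) of_nat_Suc)
        then show "y \<in> box (real (Suc n))" by (simp add: box_def)
      qed
    qed
    also have "(\<Union>n. box (real n)) = UNIV"
    proof (intro set_eqI iffI UNIV_I)
      fix y :: "real ^ 'd"
      obtain n where n: "norm y < real n" using reals_Archimedean2 by blast
      have "y \<in> box (real n)"
        unfolding box_def
      proof (intro CollectI allI)
        fix i
        have "\<bar>y $ i\<bar> \<le> norm y" by (rule component_le_norm_cart)
        then show "- real n \<le> y $ i \<and> y $ i < real n" using n by linarith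
      qed
      then show "y \<in> (\<Union>n. box (real n))" by blast
    qed
    also have "measure \<mu> UNIV = 1" using prob_space by (simp add: space)
    \<comment> \<open>The budget: twice \<open>\<epsilon> / 10\<close> for \<open>h\<close>,
      \<open>\<epsilon> / 5\<close> for its oscillation, twice \<open>\<epsilon> / 10\<close> for
      the bad cells (three terms of \<open>\<epsilon> / 30\<close>), and
      \<open>\<epsilon> / 15\<close> for the weights.\<close>
    finally have "\<forall>\<^sub>F n in sequentially. 1 - \<epsilon> / 30 < measure \<mu> (box (real n))"
      using \<open>\<epsilon> > 0\<close> by (intro order_tendstoD) auto
    then have "\<forall>\<^sub>F n in sequentially. n \<ge> 1 \<and> 1 - \<epsilon> / 30 < measure \<mu> (box (real n))"
      using eventually_ge_at_top[of 1] by eventually_elim auto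
    then obtain b :: nat where b: "b \<ge> 1" "1 - \<epsilon> / 30 < measure \<mu> (box (real b))"
      using eventually_happens[of _ sequentially] by auto
    have outside: "measure \<mu> (- box (real b)) < \<epsilon> / 30"
      using b prob_compl[of "box (real b)"] by (simp add: Compl_eq_Diff_UNIV space)
    define D where "D = cbox (\<chi> i. - real b) (\<chi> i. real b :: real ^ 'd)"
    have D: "D \<in> sets borel" "emeasure lborel D < \<infinity>" "compact D"
      by (auto simp: D_def emeasure_lborel_cbox_eq)
    obtain h where h: "continuous_on UNIV h" and hp: "(LINT y:D|lborel. \<bar>p y - h y\<bar>) < \<epsilon> / 10"
      using continuous_L1_approximation[OF pint, of "\<epsilon> / 10"] \<open>\<epsilon> > 0\<close> unfolding D_def by auto
    have hD: "set_integrable lborel D h"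
      unfolding set_integrable_def
      by (rule borel_integrable_compact[OF D(3)]) (rule continuous_on_subset[OF h], simp)
    define \<eta> where "\<eta> = \<epsilon> / (5 * (measure lborel D + 1))"
    have v: "measure lborel D + 1 > 0" using measure_nonneg[of lborel D] by linarith
    then have "\<eta> > 0" using \<open>\<epsilon> > 0\<close> by (simp add: \<eta>_def)
    have "\<eta> * measure lborel D \<le> \<eta> * (measure lborel D + 1)" using \<open>\<eta> > 0\<close> by simp
    also have "\<dots> = \<epsilon> / 5" unfolding \<eta>_def using v by (simp add: divide_simps)
    finally have \<eta>: "\<eta> * measure lborel D \<le> \<epsilon> / 5" .
    have "uniformly_continuous_on D h"
      by (rule compact_uniformly_continuous[OF continuous_on_subset[OF h] D(3)]) simp
    then obtain \<delta> where \<delta>: "\<delta> > 0" and osc: "\<And>y z. y \<in> D \<Longrightarrow> z \<in> D \<Longrightarrow> dist y z < \<delta> \<Longrightarrow> dist (h y) (h z) < \<eta>"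
      using \<open>\<eta> > 0\<close> unfolding uniformly_continuous_on_def by metis
    \<comment> \<open>The grid of mesh \<open>b / H\<close> covers the box, and \<open>H\<close>
      makes \<open>d\<close> times twice the mesh smaller than \<delta>, as the l1 norm estimate for
      the distance requires.\<close>
    obtain H where H: "real H > 2 * real ?d * real b / \<delta>" using reals_Archimedean2 by blast
    moreover have "2 * real ?d * real b / \<delta> \<ge> 0" using \<delta> by simp
    ultimately have "H > 0" by (cases H) auto
    define \<gamma> where "\<gamma> = real b / real H"
    have \<gamma>: "\<gamma> > 0" "real H * \<gamma> = real b" "real ?d * (2 * \<gamma>) < \<delta>"
      using \<open>H > 0\<close> b H \<delta> by (auto simp: \<gamma>_def field_simps)
    have "((\<lambda>M. real (?d * (2 * H + 1)) / real (N M)) \<longlongrightarrow> 0) F"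
      by (intro real_tendsto_divide_at_top[OF tendsto_const] filterlim_compose[OF filterlim_real_sequentially N])
    then have "\<forall>\<^sub>F M in F. real (?d * (2 * H + 1)) / real (N M) < \<epsilon> / 30"
      using \<open>\<epsilon> > 0\<close> by (intro order_tendstoD) auto
    moreover have "\<forall>\<^sub>F M in F. (\<Sum>r<N M ^ ?d. \<bar>1 / real (N M) ^ ?d - measure \<mu> (R M r)\<bar>) < \<epsilon> / 30"
      unfolding R_def using \<open>\<epsilon> > 0\<close> by (intro order_tendstoD[OF mass]) auto
    moreover have "\<forall>\<^sub>F M in F. dist (real (N M) ^ ?d * w M) 1 < \<epsilon> / 30"
      using \<open>\<epsilon> > 0\<close> by (intro tendstoD[OF w(2)]) auto
    moreover have "\<forall>\<^sub>F M in F. N M \<ge> 1" using N by (simp add: filterlim_at_top)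
    ultimately show ?thesis
      using x w(1)
    proof eventually_elim
      case (elim M)
      define G where "G = {r. r < N M ^ ?d \<and> \<not> hit (N M) (x M) (\<lambda>_ _. grid_points H \<gamma>) ?d r \<and> R M r \<inter> box (real b) \<noteq> {}}"
      \<comment> \<open>Both points are compared with a point \<open>u\<close> of the cell that lies
        in the box, whence twice the mesh.\<close>
      have near: "z \<in> D \<and> (\<forall>i. \<bar>y $ i - z $ i\<bar> \<le> 2 * \<gamma>)"
        if r: "r \<in> G" and yz: "y \<in> R M r" "z \<in> R M r" for r y z
      proof -
        obtain u where u: "u \<in> R M r" "u \<in> box (real b)" using r unfolding G_def by blast
        have "- real b \<le> z $ i \<and> z $ i \<le> real b \<and> \<bar>y $ i - z $ i\<bar> \<le> 2 * \<gamma>" for i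
        proof -
          obtain l where l: "l < ?d" "e l = i"
            using e unfolding bij_betw_def by (metis UNIV_I imageE lessThan_iff)
          have nh: "\<not> hit (N M) (x M) (\<lambda>_ _. grid_points H \<gamma>) ?d r" using r by (simp add: G_def)
          have ub: "- (real H * \<gamma>) \<le> u $ e l" "u $ e l < real H * \<gamma>"
            using u(2) unfolding \<gamma>(2) by (auto simp: box_def)
          note * = not_hit_grid_imp_small[OF \<gamma>(1) nh u(1)[unfolded R_def] _ l(1) ub]
          have "\<bar>u $ e l - y $ e l\<bar> \<le> \<gamma>" "\<bar>u $ e l - z $ e l\<bar> \<le> \<gamma>"
            "- real b \<le> z $ e l" "z $ e l \<le> real b"
            using *[of y] *[of z] yz unfolding R_def \<gamma>(2) by auto
          then show ?thesis unfolding l(2) by linarith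
        qed
        then show ?thesis by (auto simp: D_def mem_box_cart)
      qed
      have "?I M \<le> ennreal (2 * (LINT y:D|lborel. \<bar>p y - h y\<bar>) + \<eta> * measure lborel D +
        2 * (\<Sum>r\<in>{..<N M ^ ?d} - G. measure \<mu> (R M r)) + (\<Sum>r<N M ^ ?d. \<bar>w M - measure \<mu> (R M r)\<bar>))"
        unfolding R_def
      proof (rule histogram_L1_bound[OF pint p(2) sets_gessaman_cell _ _ D(1,2) hD])
        show "disjoint_family_on (\<lambda>r. gessaman_cell e (N M) (x M) ?d r) {..<N M ^ ?d}"
          by (rule gessaman_cell_disjoint[OF elim(5) order_refl])
        show "(\<Union>r<N M ^ ?d. gessaman_cell e (N M) (x M) ?d r) = UNIV"
          by (rule gessaman_cell_cover[OF elim(5) order_refl])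
        show "G \<subseteq> {..<N M ^ ?d}" by (auto simp: G_def)
        show "gessaman_cell e (N M) (x M) ?d r \<subseteq> D" if "r \<in> G" for r
          using near[OF that] by (auto simp: R_def)
        show "\<bar>h y - h z\<bar> \<le> \<eta>"
          if "r \<in> G" "y \<in> gessaman_cell e (N M) (x M) ?d r" "z \<in> gessaman_cell e (N M) (x M) ?d r" for r y z
        proof -
          have yz: "y \<in> D" "z \<in> D" "\<And>i. \<bar>y $ i - z $ i\<bar> \<le> 2 * \<gamma>"
            using near[OF that(1)] that(2,3) unfolding R_def by blast+
          have "dist y z \<le> (\<Sum>i\<in>UNIV. \<bar>(y - z) $ i\<bar>)" unfolding dist_norm by (rule norm_le_l1_cart)
          also have "\<dots> \<le> (\<Sum>i\<in>(UNIV :: 'd set). 2 * \<gamma>)" using yz(3) by (intro sum_mono) simp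
          also have "\<dots> < \<delta>" using \<gamma>(3) by simp
          finally show ?thesis using osc[OF yz(1,2)] by (simp add: dist_real_def)
        qed
        show "measure \<mu> (gessaman_cell e (N M) (x M) ?d r) = (LINT y:gessaman_cell e (N M) (x M) ?d r|lborel. p y)" for r
          by (rule \<mu>_integral[OF sets_gessaman_cell])
      qed (use elim \<open>\<eta> > 0\<close> in auto)
      also have "\<dots> \<le> ennreal \<epsilon>"
      proof (rule ennreal_leI)
        have "(\<Sum>r\<in>{..<N M ^ ?d} - G. measure \<mu> (R M r)) \<le> real (?d * (2 * H + 1)) / real (N M) +
          (\<Sum>r<N M ^ ?d. \<bar>1 / real (N M) ^ ?d - measure \<mu> (R M r)\<bar>) + measure \<mu> (- box (real b))"
          unfolding R_def
          by (rule sum_bad_cell_mass_le[OF prob sets elim(5) _ box, where \<gamma> = \<gamma>])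
            (use elim(4) in \<open>auto simp: G_def R_def\<close>)
        then have bad: "(\<Sum>r\<in>{..<N M ^ ?d} - G. measure \<mu> (R M r)) \<le> \<epsilon> / 10"
          using elim(1,2) outside by linarith
        \<comment> \<open>Replacing the weight by \<open>1 / N ^ d\<close> in all
          \<open>N ^ d\<close> cells costs \<open>\<bar>N ^ d * w - 1\<bar>\<close> in
          total.\<close>
        have "(\<Sum>r<N M ^ ?d. \<bar>w M - measure \<mu> (R M r)\<bar>) \<le>
          (\<Sum>r<N M ^ ?d. \<bar>w M - 1 / real (N M) ^ ?d\<bar> + \<bar>1 / real (N M) ^ ?d - measure \<mu> (R M r)\<bar>)"
          by (intro sum_mono) linarith
        also have "\<dots> = \<bar>real (N M) ^ ?d * w M - 1\<bar> + (\<Sum>r<N M ^ ?d. \<bar>1 / real (N M) ^ ?d - measure \<mu> (R M r)\<bar>)"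
        proof -
          have n: "real (N M) ^ ?d > 0" using elim(4) by simp
          have "real (N M) ^ ?d * w M - 1 = real (N M) ^ ?d * (w M - 1 / real (N M) ^ ?d)"
            using n by (simp add: field_simps)
          then have "\<bar>real (N M) ^ ?d * w M - 1\<bar> = real (N M) ^ ?d * \<bar>w M - 1 / real (N M) ^ ?d\<bar>"
            using n by (simp add: abs_mult)
          then show ?thesis by (simp add: sum.distrib)
        qed
        finally have "(\<Sum>r<N M ^ ?d. \<bar>w M - measure \<mu> (R M r)\<bar>) \<le> \<epsilon> / 15"
          using elim(2,3) by (simp add: dist_real_def)
        then show "2 * (LINT y:D|lborel. \<bar>p y - h y\<bar>) + \<eta> * measure lborel D +
          2 * (\<Sum>r\<in>{..<N M ^ ?d} - G. measure \<mu> (R M r)) + (\<Sum>r<N M ^ ?d. \<bar>w M - measure \<mu> (R M r)\<bar>) \<le> \<epsilon>"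
          using hp \<eta> bad \<open>\<epsilon> > 0\<close> by linarith
      qed
      finally show ?case .
    qed
  qed
  show ?thesis
  proof (rule order_tendstoI)
    \<comment> \<open>A number strictly between 0 and \<open>a\<close> is finite even if
      \<open>a\<close> is infinite, so \<open>small\<close> applies to it.\<close>
    fix a :: ennreal assume "0 < a"
    then obtain c where c: "0 < c" "c < a" using dense by blast
    have "c < top" using c(2) top_greatest by (rule less_le_trans)
    with c have "c = ennreal (enn2real c)" "enn2real c > 0"
      by (auto simp: enn2real_positive_iff)
    then have "\<forall>\<^sub>F M in F. ?I M \<le> c" using small[of "enn2real c"] by simp
    then show "\<forall>\<^sub>F M in F. ?I M < a" by eventually_elim (use c in auto)
  qed simp
qed

subsection \<open>Growth of the number of cells\<close>

text \<open>Here \<open>u\<close> is the reciprocal of the number whose ceiling is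
  \<open>gessaman_N d k M\<close>, and taking the ceiling adds at most 1.\<close>

lemma gessaman_N_bounds:
  fixes M :: nat
  assumes "0 < k M" "0 < M" "d > 0"
  defines "u \<equiv> (real (k M) / real M) powr (1 / real d)"
  shows "1 \<le> real (gessaman_N d k M) * u" "real (gessaman_N d k M) * u \<le> 1 + u" "u > 0"
    and "u ^ d = real (k M) / real M"
proof -
  define t where "t = (real M / real (k M)) powr (1 / real d)"
  have t: "t > 0" and u: "u > 0" using assms by (auto simp: t_def u_def)
  have tu: "t * u = 1"
    using assms unfolding t_def u_def by (subst powr_mult[symmetric]) auto
  have N: "real (gessaman_N d k M) = real_of_int \<lceil>t\<rceil>"
    using t by (simp add: gessaman_N_def t_def)
  have "t * u \<le> real (gessaman_N d k M) * u"
    unfolding N using u by (intro mult_right_mono) auto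
  then show "1 \<le> real (gessaman_N d k M) * u" using tu by simp
  have "real (gessaman_N d k M) \<le> t + 1" unfolding N by (rule of_int_ceiling_le_add_one)
  then have "real (gessaman_N d k M) * u \<le> (t + 1) * u" using u by (intro mult_right_mono) auto
  then show "real (gessaman_N d k M) * u \<le> 1 + u" using tu by (simp add: distrib_right)
  show "u > 0" by fact
  show "u ^ d = real (k M) / real M"
    using assms unfolding u_def by (simp add: powr_realpow[symmetric] powr_powr)
qed

text \<open>As \<open>u\<close> tends to 0, the product of \<open>gessaman_N d k M\<close> and
  \<open>u\<close> is squeezed between 1 and \<open>1 + u\<close>; its \<open>d\<close>-th power
  gives the second limit, and the lower bound \<open>1 / u\<close> gives the first.\<close>

lemma gessaman_N_asymptotics:
  assumes pos: "\<forall>\<^sub>F M in F. 0 < k M \<and> 0 < M" and "d > 0"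
    and lim: "((\<lambda>M. real (k M) / real M) \<longlongrightarrow> 0) F"
  shows "filterlim (gessaman_N d k) at_top F"
    and "((\<lambda>M. real (gessaman_N d k M) ^ d * (real (k M) / real M)) \<longlongrightarrow> 1) F"
proof -
  define u where "u M = (real (k M) / real M) powr (1 / real d)" for M
  note b = gessaman_N_bounds[OF _ _ \<open>d > 0\<close>, of k, folded u_def]
  have u0: "(u \<longlongrightarrow> 0) F"
    unfolding u_def[abs_def] using \<open>d > 0\<close> by (intro tendsto_zero_powrI[OF lim tendsto_const]) auto
  have Nu: "((\<lambda>M. real (gessaman_N d k M) * u M) \<longlongrightarrow> 1) F"
  proof (rule tendsto_sandwich[where f = "\<lambda>_. 1" and h = "\<lambda>M. 1 + u M"])
    show "((\<lambda>M. 1 + u M) \<longlongrightarrow> 1) F" using tendsto_add[OF tendsto_const u0, of 1] by simp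
    show "\<forall>\<^sub>F M in F. 1 \<le> real (gessaman_N d k M) * u M"
      using pos by eventually_elim (use b in auto)
    show "\<forall>\<^sub>F M in F. real (gessaman_N d k M) * u M \<le> 1 + u M"
      using pos by eventually_elim (use b in auto)
  qed simp
  have "((\<lambda>M. (real (gessaman_N d k M) * u M) ^ d) \<longlongrightarrow> 1) F"
    using tendsto_power[OF Nu, of d] by simp
  then show "((\<lambda>M. real (gessaman_N d k M) ^ d * (real (k M) / real M)) \<longlongrightarrow> 1) F"
  proof (rule Lim_transform_eventually)
    show "\<forall>\<^sub>F M in F. (real (gessaman_N d k M) * u M) ^ d = real (gessaman_N d k M) ^ d * (real (k M) / real M)"
      using pos by eventually_elim (simp add: power_mult_distrib b)
  qed
  have "filterlim (\<lambda>M. inverse (u M)) at_top F"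
    by (rule filterlim_inverse_at_top[OF u0]) (use pos b in \<open>auto elim: eventually_mono\<close>)
  then have "filterlim (\<lambda>M. real (gessaman_N d k M)) at_top F"
  proof (rule filterlim_at_top_mono)
    show "\<forall>\<^sub>F M in F. inverse (u M) \<le> real (gessaman_N d k M)"
      using pos
    proof eventually_elim
      case (elim M)
      then have "1 \<le> real (gessaman_N d k M) * u M" "u M > 0" using b by auto
      then show ?case by (simp add: inverse_eq_divide pos_divide_le_eq)
    qed
  qed
  then show "filterlim (gessaman_N d k) at_top F"
    by (simp add: filterlim_sequentially_iff_filterlim_real)
qed

text \<open>The ratio \<open>(K * N) ^ d / M\<close> equals
  \<open>K ^ d * (N ^ d * (k / M)) / k\<close>, whose numerator is bounded. This is where growth of
  \<open>k\<close> makes the union bound affordable.\<close>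

lemma cells_negligible:
  assumes "filterlim k at_top F" and pos: "\<forall>\<^sub>F M in F. 0 < k M \<and> 0 < M"
    and lim: "((\<lambda>M. real (N M) ^ d * (real (k M) / real M)) \<longlongrightarrow> 1) F" and "\<epsilon> > 0"
  shows "\<forall>\<^sub>F M in F. real ((K * N M) ^ d) \<le> \<epsilon> * real M"
proof -
  have "((\<lambda>M. real K ^ d * (real (N M) ^ d * (real (k M) / real M)) / real (k M)) \<longlongrightarrow> 0) F"
    by (intro real_tendsto_divide_at_top[OF tendsto_mult[OF tendsto_const lim]]
        filterlim_compose[OF filterlim_real_sequentially assms(1)])
  then have "\<forall>\<^sub>F M in F. real K ^ d * (real (N M) ^ d * (real (k M) / real M)) / real (k M) < \<epsilon>"
    using \<open>\<epsilon> > 0\<close> by (intro order_tendstoD) auto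
  then show ?thesis
    using pos by eventually_elim (simp add: field_simps power_mult_distrib)
qed

subsection \<open>Consistency\<close>

text \<open>There is at least one coordinate, so the counts of the last stage apply to every final
  cell; divisibility makes the natural division exact.\<close>

lemma gessaman_cutsD:
  fixes e :: "nat \<Rightarrow> 'd::finite"
  assumes cuts: "gessaman_cuts e N M s x" and dvd: "N ^ CARD('d) dvd M" and "M > 0" "N > 0"
  shows "cut_structure CARD('d) N x"
    and "r < N ^ CARD('d) \<Longrightarrow> empirical M s (gessaman_cell e N x CARD('d) r) = 1 / real N ^ CARD('d)"
proof -
  show "cut_structure CARD('d) N x" using cuts unfolding gessaman_cuts_def cut_structure_def by blast
  assume r: "r < N ^ CARD('d)"
  obtain i where i: "CARD('d) = Suc i" by (metis card_eq_0_iff finite UNIV_not_empty not0_implies_Suc)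
  note q = div_less_power[OF r[unfolded i]]
  have "card {m. m < M \<and> s m \<in> gessaman_cell e N x (Suc i) (N * (r div N) + r mod N)} = M div N ^ Suc i"
    using cuts[unfolded gessaman_cuts_def, rule_format, of i "r div N"] q(1,2) i by simp
  then have c: "card {m. m < M \<and> s m \<in> gessaman_cell e N x CARD('d) r} = M div N ^ CARD('d)"
    by (simp add: i)
  show "empirical M s (gessaman_cell e N x CARD('d) r) = 1 / real N ^ CARD('d)"
    unfolding empirical_def c using dvd \<open>M > 0\<close> \<open>N > 0\<close> by (simp add: real_of_nat_div)
qed

lemma AE_cell_mass_consistent:
  fixes Y :: "nat \<Rightarrow> 'b \<Rightarrow> real ^ 'd::finite" and e :: "nat \<Rightarrow> 'd" and x :: "nat \<Rightarrow> 'b \<Rightarrow> nat \<Rightarrow> nat \<Rightarrow> nat \<Rightarrow> ereal"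
  assumes "prob_space P" and indep: "prob_space.indep_vars P (\<lambda>_. borel) Y UNIV"
    and distr: "\<And>m. distr P borel (Y m) = \<mu>" and null: "\<And>k t. measure \<mu> {y. y $ k = t} = 0"
    and pos: "\<And>M. M \<in> A \<Longrightarrow> 0 < N M \<and> 0 < M \<and> N M ^ CARD('d) dvd M"
    and small: "\<And>K \<epsilon>. \<epsilon> > 0 \<Longrightarrow> \<forall>\<^sub>F M in inf at_top (principal A). real ((K * N M) ^ CARD('d)) \<le> \<epsilon> * real M"
    and cuts: "\<And>M. M \<in> A \<Longrightarrow> AE \<omega> in P. gessaman_cuts e (N M) M (\<lambda>m\<in>{..<M}. Y m \<omega>) (x M \<omega>)"
  shows "AE \<omega> in P. (\<forall>M\<in>A. cut_structure CARD('d) (N M) (x M \<omega>)) \<and>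
    ((\<lambda>M. \<Sum>r<N M ^ CARD('d). \<bar>1 / real (N M) ^ CARD('d) -
        measure \<mu> (gessaman_cell e (N M) (x M \<omega>) CARD('d) r)\<bar>) \<longlongrightarrow> 0) (inf at_top (principal A))"
proof -
  interpret prob_space P by fact
  let ?d = "CARD('d)" and ?F = "inf at_top (principal A)"
  have Y: "Y m \<in> borel_measurable P" for m using indep by (auto simp: indep_vars_def)
  have \<mu>: "prob_space \<mu>" "sets \<mu> = sets borel"
    using prob_space_distr[OF Y, of 0] distr[of 0] by auto
  have "\<exists>z. (\<forall>d. cut_structure d L z) \<and>
      (\<forall>i. \<forall>q<L ^ i. measure \<mu> (gessaman_cell e L z i q) = 1 / real L ^ i)" if "L > 0" for L
    by (rule ex_quantile_cuts[OF \<mu> null that])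
  \<comment> \<open>The quantile cuts are fixed once for each \<open>L\<close>, before any outcome,
    so the cells \<open>Q\<close> are deterministic.\<close>
  then obtain z where z: "\<And>L d. L > 0 \<Longrightarrow> cut_structure d L (z L)"
    and zmass: "\<And>L i q. L > 0 \<Longrightarrow> q < L ^ i \<Longrightarrow> measure \<mu> (gessaman_cell e L (z L) i q) = 1 / real L ^ i"
    by metis
  define Q where "Q K M q = gessaman_cell e (K * N M) (z (K * N M)) ?d q" for K M q
  have "AE \<omega> in P. \<forall>\<^sub>F M in ?F. \<forall>I\<subseteq>{..<(K * N M) ^ ?d}.
      empirical M (\<lambda>m. Y m \<omega>) (\<Union>q\<in>I. Q K M q) \<le> measure \<mu> (\<Union>q\<in>I. Q K M q) + 1 / real K" if "K > 0" for K
    by (rule AE_uniform_deviation[OF indep distr _ _ small])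
      (use that in \<open>auto simp: Q_def sets_gessaman_cell\<close>)
  \<comment> \<open>The tolerance \<open>1 / K\<close> is tied to the refinement \<open>K\<close>,
    so a countable intersection over \<open>K\<close> leaves one null set.\<close>
  then have dev: "AE \<omega> in P. \<forall>K\<in>{0<..}. \<forall>\<^sub>F M in ?F. \<forall>I\<subseteq>{..<(K * N M) ^ ?d}.
      empirical M (\<lambda>m. Y m \<omega>) (\<Union>q\<in>I. Q K M q) \<le> measure \<mu> (\<Union>q\<in>I. Q K M q) + 1 / real K"
    by (subst AE_ball_countable) auto
  have "AE \<omega> in P. \<forall>M\<in>A. gessaman_cuts e (N M) M (\<lambda>m\<in>{..<M}. Y m \<omega>) (x M \<omega>)"
    using cuts by (subst AE_ball_countable) auto
  with dev show ?thesis
  proof eventually_elim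
    case (elim \<omega>)
    have cut: "cut_structure ?d (N M) (x M \<omega>)"
      and emp: "\<And>r. r < N M ^ ?d \<Longrightarrow> empirical M (\<lambda>m. Y m \<omega>) (gessaman_cell e (N M) (x M \<omega>) ?d r) = 1 / real (N M) ^ ?d"
      if "M \<in> A" for M
    proof -
      have g: "gessaman_cuts e (N M) M (\<lambda>m\<in>{..<M}. Y m \<omega>) (x M \<omega>)" using elim(2) that by blast
      show "cut_structure ?d (N M) (x M \<omega>)" by (intro gessaman_cutsD(1)[OF g]) (use pos[OF that] in auto)
      \<comment> \<open>Only the first \<open>M\<close> points count, so the restricted sample has
        the same empirical masses.\<close>
      have eq: "empirical M (\<lambda>m\<in>{..<M}. Y m \<omega>) S = empirical M (\<lambda>m. Y m \<omega>) S" for S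
        unfolding empirical_def by (rule arg_cong[where f = "\<lambda>T. real (card T) / real M"]) auto
      show "empirical M (\<lambda>m. Y m \<omega>) (gessaman_cell e (N M) (x M \<omega>) ?d r) = 1 / real (N M) ^ ?d"
        if "r < N M ^ ?d" for r
        unfolding eq[symmetric]
        by (intro gessaman_cutsD(2)[OF g _ _ _ that]) (use pos[OF \<open>M \<in> A\<close>] in auto)
    qed
    have "((\<lambda>M. \<Sum>r<N M ^ ?d. \<bar>1 / real (N M) ^ ?d - measure \<mu> (gessaman_cell e (N M) (x M \<omega>) ?d r)\<bar>) \<longlongrightarrow> 0) ?F"
    proof (rule tendstoI)
      fix \<epsilon> :: real assume "\<epsilon> > 0"
      \<comment> \<open>The bound \<open>2 * (\<epsilon> + d / K)\<close> of
        \<open>cell_mass_deviation_le\<close>, with tolerance \<open>1 / K\<close>, becomes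
        \<open>2 * (1 + d) / K\<close>.\<close>
      obtain K where K: "real K > 2 * (1 + real ?d) / \<epsilon>" using reals_Archimedean2 by blast
      moreover have "2 * (1 + real ?d) / \<epsilon> > 0" using \<open>\<epsilon> > 0\<close> by simp
      ultimately have "K > 0" by (cases K) auto
      have K\<epsilon>: "2 * (1 / real K + real ?d / real K) < \<epsilon>"
        using K \<open>K > 0\<close> \<open>\<epsilon> > 0\<close> by (simp add: field_simps)
      have "\<forall>\<^sub>F M in ?F. M \<in> A" by (simp add: eventually_inf_principal)
      moreover have "\<forall>\<^sub>F M in ?F. \<forall>I\<subseteq>{..<(K * N M) ^ ?d}.
          empirical M (\<lambda>m. Y m \<omega>) (\<Union>q\<in>I. Q K M q) \<le> measure \<mu> (\<Union>q\<in>I. Q K M q) + 1 / real K"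
        using elim(1) \<open>K > 0\<close> by blast
      ultimately show "\<forall>\<^sub>F M in ?F. dist (\<Sum>r<N M ^ ?d. \<bar>1 / real (N M) ^ ?d -
          measure \<mu> (gessaman_cell e (N M) (x M \<omega>) ?d r)\<bar>) 0 < \<epsilon>"
      proof eventually_elim
        case (elim M)
        have NM: "N M > 0" using pos elim(1) by blast
        then have L: "K * N M > 0" using \<open>K > 0\<close> by simp
        have "(\<Sum>r<N M ^ ?d. \<bar>1 / real (N M) ^ ?d - measure \<mu> (gessaman_cell e (N M) (x M \<omega>) ?d r)\<bar>)
          \<le> 2 * (1 / real K + real ?d / real K)"
          by (rule cell_mass_deviation_le[OF \<mu> cut[OF elim(1)] z[OF L] NM \<open>K > 0\<close> zmass[OF L] emp[OF elim(1)]])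
            (use elim(2) in \<open>auto simp: Q_def\<close>)
        then have "(\<Sum>r<N M ^ ?d. \<bar>1 / real (N M) ^ ?d - measure \<mu> (gessaman_cell e (N M) (x M \<omega>) ?d r)\<bar>) < \<epsilon>"
          using K\<epsilon> by linarith
        then show ?case by (simp add: sum_nonneg)
      qed
    qed
    with cut show ?case by blast
  qed
qed

theorem theorem3p5:
  fixes b :: "real ^ 'd \<Rightarrow> real ^ 'd"
    and \<sigma> :: "real ^ 'd \<Rightarrow> real ^ 'd ^ 'd"
    and p0 pJ :: "real ^ 'd \<Rightarrow> real"
    and J :: nat and T \<tau> :: real
    and \<Omega> :: "'a measure"
    and W :: "real \<Rightarrow> 'a \<Rightarrow> real ^ 'd"
    and X0 :: "'a \<Rightarrow> real ^ 'd"
    and P :: "'b measure"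
    and Y :: "nat \<Rightarrow> 'b \<Rightarrow> real ^ 'd"
    and k :: "nat \<Rightarrow> nat"
    and e :: "nat \<Rightarrow> 'd"
    and A :: "nat set" and N :: "nat \<Rightarrow> nat"
    and sample :: "nat \<Rightarrow> 'b \<Rightarrow> nat \<Rightarrow> real ^ 'd"
    and c :: "nat \<Rightarrow> (nat \<Rightarrow> real ^ 'd) \<Rightarrow> nat \<Rightarrow> nat \<Rightarrow> nat \<Rightarrow> ereal"
  assumes "smooth_bounded_derivs b"
    and "smooth_bounded_derivs \<sigma>"
    and "uniformly_elliptic \<sigma>"
    and "\<forall>x. 0 \<le> p0 x"
    and "has_bochner_integral lborel p0 1"
    and "J \<ge> 1" and "T > 0" and "\<tau> = T / real J"
    and "prob_space \<Omega>"
    and "wiener_process \<Omega> T W"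
    and "distributed \<Omega> lborel X0 (\<lambda>x. ennreal (p0 x))"
    and "independent_rvs \<Omega> borel X0 (Pi\<^sub>M {0..T} (\<lambda>_. borel)) (\<lambda>\<omega>. \<lambda>t\<in>{0..T}. W t \<omega>)"
    and "\<forall>x. 0 \<le> pJ x"
    and "distributed \<Omega> lborel (euler b \<sigma> \<tau> X0 W J) (\<lambda>x. ennreal (pJ x))"
    and "prob_space P"
    and "prob_space.indep_vars P (\<lambda>_. borel) Y UNIV"
    and "\<forall>m. distr P borel (Y m) = distr \<Omega> borel (euler b \<sigma> \<tau> X0 W J)"
    and "N = gessaman_N CARD('d) k"
    and "A = admissible CARD('d) k"
    and "sample = (\<lambda>M \<omega>. \<lambda>m\<in>{..<M}. Y m \<omega>)"
    and "infinite A"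
    and "\<forall>M\<in>A. k M < M"
    and "filterlim k at_top (inf at_top (principal A))"
    and "((\<lambda>M. real (k M) / real M) \<longlongrightarrow> 0) (inf at_top (principal A))"
    and "bij_betw e {..<CARD('d)} UNIV"
    and "\<forall>M\<in>A. measurable_cut_rule CARD('d) (N M) M (c M)"
    and "\<forall>M\<in>A. AE \<omega> in P. gessaman_cuts e (N M) M (sample M \<omega>) (c M (sample M \<omega>))"
  shows "AE \<omega> in P.
    ((\<lambda>M. \<integral>\<^sup>+ y. ennreal \<bar>pJ y - gessaman_estimator e (N M) M (k M) (c M (sample M \<omega>)) y\<bar> \<partial>lborel)
      \<longlongrightarrow> 0) (inf at_top (principal A))"
proof -
  interpret P: prob_space P by fact
  let ?F = "inf at_top (principal A)" and ?d = "CARD('d)"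
  define \<mu> where "\<mu> = density lborel (\<lambda>x. ennreal (pJ x))"
  have dens: "distr \<Omega> lborel (euler b \<sigma> \<tau> X0 W J) = \<mu>"
    and meas: "(\<lambda>x. ennreal (pJ x)) \<in> borel_measurable borel"
    using assms(14) by (auto simp: distributed_def \<mu>_def)
  have pJ: "pJ \<in> borel_measurable borel"
    using borel_measurable_enn2real[OF meas] assms(13) by simp
  have distr: "distr P borel (Y m) = \<mu>" for m
    unfolding dens[symmetric] using assms(17) by (auto intro!: distr_cong)
  have "Y 0 \<in> borel_measurable P" using assms(16) by (auto simp: P.indep_vars_def)
  from P.prob_space_distr[OF this] have \<mu>: "prob_space \<mu>" unfolding distr .
  have pos: "0 < k M" "0 < M" "N M ^ ?d dvd M" if "M \<in> A" for M
    using that assms(18,19) by (auto simp: admissible_def)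
  have A: "\<forall>\<^sub>F M in ?F. M \<in> A" by (simp add: eventually_inf_principal)
  then have pos': "\<forall>\<^sub>F M in ?F. 0 < k M \<and> 0 < M" by eventually_elim (use pos in auto)
  have N: "filterlim N at_top ?F"
    and Nk: "((\<lambda>M. real (N M) ^ ?d * (real (k M) / real M)) \<longlongrightarrow> 1) ?F"
    unfolding assms(18) by (rule gessaman_N_asymptotics[OF pos' _ assms(24)]; simp)+
  have Npos: "0 < N M" if "M \<in> A" for M
    using gessaman_N_bounds(1)[of k M ?d] pos[OF that] unfolding assms(18) by (cases "gessaman_N ?d k M") auto
  \<comment> \<open>All randomness is spent here; what remains is
    \<open>histogram_consistent\<close> for a fixed outcome, with weight
    \<open>k M / M\<close>.\<close>
  have "AE \<omega> in P. (\<forall>M\<in>A. cut_structure ?d (N M) (c M (sample M \<omega>))) \<and>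
    ((\<lambda>M. \<Sum>r<N M ^ ?d. \<bar>1 / real (N M) ^ ?d -
        measure \<mu> (gessaman_cell e (N M) (c M (sample M \<omega>)) ?d r)\<bar>) \<longlongrightarrow> 0) ?F"
  proof (rule AE_cell_mass_consistent[OF assms(15,16) distr])
    show "measure \<mu> {y. y $ k = t} = 0" for k t
      unfolding \<mu>_def by (rule hyperplane_null_density[OF meas])
    show "0 < N M \<and> 0 < M \<and> N M ^ ?d dvd M" if "M \<in> A" for M using pos[OF that] Npos[OF that] by simp
    show "\<forall>\<^sub>F M in ?F. real ((K * N M) ^ ?d) \<le> \<epsilon> * real M" if "\<epsilon> > 0" for K \<epsilon>
      by (rule cells_negligible[OF assms(23) pos' Nk that])
    show "AE \<omega> in P. gessaman_cuts e (N M) M (\<lambda>m\<in>{..<M}. Y m \<omega>) (c M (sample M \<omega>))" if "M \<in> A" for M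
      using assms(27) that unfolding assms(20) by blast
  qed
  then show ?thesis
  proof eventually_elim
    case (elim \<omega>)
    have cut: "\<forall>\<^sub>F M in ?F. cut_structure ?d (N M) (c M (sample M \<omega>))"
      using A by eventually_elim (use elim in blast)
    show ?case
      unfolding gessaman_estimator_eq
      by (rule histogram_consistent[OF pJ _ \<mu>_def \<mu> assms(25) cut N _ Nk conjunct2[OF elim]])
        (use assms(13) in auto)
  qed
qed

end
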